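(* Let $(\mathfrak g,\mu=[\ ,\ ])$ be a Lie algebra over a field of characteristic zero. Then the graded vector space $\bigoplus_{n\ge0}\mathrm{Hom}(\wedge^n\mathfrak g,\mathfrak g)$ (with $\mathrm{Hom}(\wedge^n\mathfrak g,\mathfrak g)$ in degree $n$) carries an $L_\infty$-algebra structure whose only nontrivial structure maps are $l_2=\llbracket\ ,\ \rrbracket$ and $l_3=\llbracket\ ,\ ,\ \rrbracket$, the brackets defined in the context for $M=\mathfrak g$ the adjoint module and $H=-\mu$. Moreover, a linear map $R:\mathfrak g\to\mathfrak g$ is a Reynolds operator on $\mathfrak g$ if and only if $R$ is a Maurer-Cartan element in this $L_\infty$-algebra.
   Context: A Reynolds operator on $\mathfrak g$ is a linear map $R:\mathfrak g\to\mathfrak g$ with $[Rx,Ry]=R([Rx,y]+[x,Ry]-[Rx,Ry])$ for all $x,y\in\mathfrak g$. $L_\infty$-algebra: a graded vector space $L=\bigoplus_i L_i$ with multilinear maps $l_k:L^{\otimes k}\to L$ of degree $2-k$ ($k\ge1$) such that (i) $l_k(x_{\sigma(1)},\dots,x_{\sigma(k)})=(-1)^\sigma\epsilon(\sigma)\,l_k(x_1,\dots,x_k)$ for $\sigma\in S_k$, where $(-1)^\sigma$ is the signature and $\epsilon(\sigma)$ the Koszul sign; (ii) for each $n\ge1$, $\sum_{i+j=n+1}\sum_\sigma(-1)^\sigma\epsilon(\sigma)(-1)^{i(j-1)}l_j(l_i(x_{\sigma(1)},\dots,x_{\sigma(i)}),x_{\sigma(i+1)},\dots,x_{\sigma(n)})=0$,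 with $\sigma$ running over $(i,n-i)$-unshuffles, $i\ge 1$. A Maurer-Cartan element is $\alpha\in L_1$ with $l_1(\alpha)+\frac1{2!}l_2(\alpha,\alpha)-\frac1{3!}l_3(\alpha,\alpha,\alpha)-\cdots=0$; when only $l_2,l_3$ are nonzero this reads $\frac12 l_2(\alpha,\alpha)-\frac16 l_3(\alpha,\alpha,\alpha)=0$. Brackets, for a Lie algebra $\mathfrak g$, a $\mathfrak g$-module $M$ (action $x\bullet u$) and a Chevalley-Eilenberg $2$-cocycle $H:\wedge^2\mathfrak g\to M$ (here $M=\mathfrak g$, $x\bullet y=[x,y]$, $H(x,y)=-[x,y]$): $Sh(a,b,c)$ denotes permutations of $\{1,\dots,a+b+c\}$ increasing on each of the three consecutive blocks of sizes $a,b,c$ (similarly $Sh(a,b)$); a sum over $Sh(a,b,-1)$ is zero. For $P\in\mathrm{Hom}(\wedge^pM,\mathfrak g)$, $Q\in\mathrm{Hom}(\wedge^qM,\mathfrak g)$, $R\in\mathrm{Hom}(\wedge^rM,\mathfrak g)$: $$\begin{aligned}\llbracket P,Q\rrbracket(u_1,\dots,u_{p+q})=&\sum_{\sigma\in Sh(q,1,p-1)}(-1)^\sigma P\big(Q(u_{\sigma(1)},\dots,u_{\sigma(q)})\bullet u_{\sigma(q+1)},u_{\sigma(q+2)},\dots,u_{\sigma(p+q)}\big)\\&-(-1)^{pq}\sum_{\sigma\in Sh(p,1,q-1)}(-1)^\sigma Q\big(P(u_{\sigma(1)},\dots,u_{\sigma(p)})\bullet u_{\sigma(p+1)},u_{\sigma(p+2)},\dots,u_{\sigma(p+q)}\big)\\&+(-1)^{pq}\sum_{\sigma\in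 Sh(p,q)}(-1)^\sigma\big[P(u_{\sigma(1)},\dots,u_{\sigma(p)}),Q(u_{\sigma(p+1)},\dots,u_{\sigma(p+q)})\big],\end{aligned}$$ $$\begin{aligned}&\llbracket P,Q,R\rrbracket(u_1,\dots,u_{p+q+r-1})\\&=(-1)^{pqr}\,\frac12\bigg\{\sum_{\sigma\in Sh(q,r,p-1)}(-1)^\sigma P\big(H(Q(u_{\sigma(1)},\dots,u_{\sigma(q)}),R(u_{\sigma(q+1)},\dots,u_{\sigma(q+r)})),u_{\sigma(q+r+1)},\dots,u_{\sigma(p+q+r-1)}\big)\\&-(-1)^{qr}\sum_{\sigma\in Sh(r,q,p-1)}(-1)^\sigma P\big(H(R(u_{\sigma(1)},\dots,u_{\sigma(r)}),Q(u_{\sigma(r+1)},\dots,u_{\sigma(q+r)})),u_{\sigma(q+r+1)},\dots,u_{\sigma(p+q+r-1)}\big)\\&-(-1)^{pq}\sum_{\sigma\in Sh(p,r,q-1)}(-1)^\sigma Q\big(H(P(u_{\sigma(1)},\dots,u_{\sigma(p)}),R(u_{\sigma(p+1)},\dots,u_{\sigma(p+r)})),u_{\sigma(p+r+1)},\dots,u_{\sigma(p+q+r-1)}\big)\\&+(-1)^{p(q+r)}\sum_{\sigma\in Sh(r,p,q-1)}(-1)^\sigma Q\big(H(R(u_{\sigma(1)},\dots,u_{\sigma(r)}),P(u_{\sigma(r+1)},\dots,u_{\sigma(p+r)})),u_{\sigma(p+r+1)},\dots,u_{\sigma(p+q+r-1)}\big)\\&+(-1)^{(p+q)r}\sum_{\sigma\in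 Sh(p,q,r-1)}(-1)^\sigma R\big(H(P(u_{\sigma(1)},\dots,u_{\sigma(p)}),Q(u_{\sigma(p+1)},\dots,u_{\sigma(p+q)})),u_{\sigma(p+q+1)},\dots,u_{\sigma(p+q+r-1)}\big)\\&-(-1)^{pq+qr+rp}\sum_{\sigma\in Sh(q,p,r-1)}(-1)^\sigma R\big(H(Q(u_{\sigma(1)},\dots,u_{\sigma(q)}),P(u_{\sigma(q+1)},\dots,u_{\sigma(p+q)})),u_{\sigma(p+q+1)},\dots,u_{\sigma(p+q+r-1)}\big)\bigg\}.\end{aligned}$$
   Formalization: In the ternary bracket the common prefactor (-1)^{pqr} is replaced, for terms with outer map P, by (-1)^{p+1+qr} (likewise for Q, R); with the stated prefactor the n=4 identity fails, e.g. for (a,b,id,id) on sl_2. The Maurer-Cartan equation is unaffected. *)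

theory Defs
  imports Complex_Main "HOL-Combinatorics.Permutations" "HOL-Library.Function_Algebras"
begin

text \<open>
  Permutations act on the indices 0, ..., n - 1 and an n-tuple of arguments is a list of
  length n; all indices are thus shifted by one against the usual 1, ..., n.
\<close>

section \<open>Shuffles and signs\<close>

definition Sh2 :: "nat \<Rightarrow> nat \<Rightarrow> (nat \<Rightarrow> nat) set" where
  "Sh2 a b = {\<sigma>. \<sigma> permutes {..<a + b} \<and>
     strict_mono_on {..<a} \<sigma> \<and> strict_mono_on {a..<a + b} \<sigma>}"

text \<open>The last argument is an integer because the sums over (a, b, -1)-shuffles are zero.\<close>

definition Sh3 :: "nat \<Rightarrow> nat \<Rightarrow> int \<Rightarrow> (nat \<Rightarrow> nat) set" where
  "Sh3 a b c = {\<sigma>. 0 \<le> c \<and> \<sigma> permutes {..<a + b + nat c} \<and>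
     strict_mono_on {..<a} \<sigma> \<and> strict_mono_on {a..<a + b} \<sigma> \<and>
     strict_mono_on {a + b..<a + b + nat c} \<sigma>}"

definition koszul_sign :: "nat \<Rightarrow> (nat \<Rightarrow> int) \<Rightarrow> (nat \<Rightarrow> nat) \<Rightarrow> int" where
  "koszul_sign n d \<sigma> = (\<Prod>(i, j)\<in>{(i, j). i < j \<and> j < n \<and> \<sigma> j < \<sigma> i}.
     if even (d (\<sigma> i) * d (\<sigma> j)) then 1 else -1)"


section \<open>\<open>L\<^sub>\<infinity>\<close>-algebras\<close>

definition multilinear_on ::
  "('k \<Rightarrow> 'a \<Rightarrow> 'a) \<Rightarrow> ('k \<Rightarrow> 'b \<Rightarrow> 'b) \<Rightarrow> 'a::ab_group_add set \<Rightarrow> nat \<Rightarrow>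
   ('a list \<Rightarrow> 'b::ab_group_add) \<Rightarrow> bool"
where
  "multilinear_on sa sb V n f \<longleftrightarrow>
     (\<forall>xs ys x y c. length xs + 1 + length ys = n \<and> set xs \<subseteq> V \<and> set ys \<subseteq> V \<and> x \<in> V \<and> y \<in> V \<longrightarrow>
        f (xs @ (x + y) # ys) = f (xs @ x # ys) + f (xs @ y # ys) \<and>
        f (xs @ sa c x # ys) = sb c (f (xs @ x # ys)))"

text \<open>The graded vector space is the internal direct sum \<open>total\<close> of the subspaces \<open>L i\<close>; it
  need not exhaust the ambient type.\<close>

locale graded_vector_space = vector_space scale
  for scale :: "'k::field \<Rightarrow> 'v::ab_group_add \<Rightarrow> 'v" +
  fixes L :: "int \<Rightarrow> 'v set"
  assumes subspace_component: "subspace (L i)"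
    and independent_components:
      "finite I \<Longrightarrow> (\<And>i. i \<in> I \<Longrightarrow> x i \<in> L i) \<Longrightarrow> (\<Sum>i\<in>I. x i) = 0 \<Longrightarrow> i \<in> I \<Longrightarrow> x i = 0"
begin

definition total :: "'v set" where
  "total = span (\<Union>i. L i)"

end

text \<open>\<open>l k\<close> is only relevant on lists of length \<open>k\<close> with entries in \<open>total\<close>, and for \<open>k \<ge> 1\<close>.\<close>

locale L_infinity_algebra = graded_vector_space scale L
  for scale :: "'k::field \<Rightarrow> 'v::ab_group_add \<Rightarrow> 'v" and L :: "int \<Rightarrow> 'v set" +
  fixes l :: "nat \<Rightarrow> 'v list \<Rightarrow> 'v"
  assumes multilinear: "1 \<le> k \<Longrightarrow> multilinear_on scale scale total k (l k)"
    and degree: "1 \<le> k \<Longrightarrow> (\<And>i. i < k \<Longrightarrow> x i \<in> L (d i)) \<Longrightarrow>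
      l k (map x [0..<k]) \<in> L ((\<Sum>i<k. d i) + 2 - int k)"
    and antisymmetric: "1 \<le> k \<Longrightarrow> (\<And>i. i < k \<Longrightarrow> x i \<in> L (d i)) \<Longrightarrow> \<sigma> permutes {..<k} \<Longrightarrow>
      l k (map (x \<circ> \<sigma>) [0..<k]) =
        scale (of_int (sign \<sigma> * koszul_sign k d \<sigma>)) (l k (map x [0..<k]))"
    and higher_jacobi: "1 \<le> n \<Longrightarrow> (\<And>i. i < n \<Longrightarrow> x i \<in> L (d i)) \<Longrightarrow>
      (\<Sum>i\<in>{1..n}. \<Sum>\<sigma>\<in>Sh2 i (n - i).
         scale (of_int (sign \<sigma> * koszul_sign n d \<sigma>) * (-1) ^ (i * (n - i)))
           (l (n + 1 - i) (l i (map (x \<circ> \<sigma>) [0..<i]) # map (x \<circ> \<sigma>) [i..<n]))) = 0"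

text \<open>
  The Maurer-Cartan equation \<open>l\<^sub>1(\<alpha>) + l\<^sub>2(\<alpha>,\<alpha>)/2! - l\<^sub>3(\<alpha>,\<alpha>,\<alpha>)/3! - ... = 0\<close>, whose signs have
  period four (\<open>+ + - -\<close>).  Without a topology its left-hand side makes sense only if it has
  finitely many nonzero terms.
\<close>

definition maurer_cartan ::
  "('k::field_char_0 \<Rightarrow> 'v::ab_group_add \<Rightarrow> 'v) \<Rightarrow> (int \<Rightarrow> 'v set) \<Rightarrow> (nat \<Rightarrow> 'v list \<Rightarrow> 'v) \<Rightarrow> 'v \<Rightarrow> bool"
where
  "maurer_cartan scale L l \<alpha> \<longleftrightarrow> \<alpha> \<in> L 1 \<and>
     finite {k. 1 \<le> k \<and> l k (replicate k \<alpha>) \<noteq> 0} \<and>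
     (\<Sum>k\<in>{k. 1 \<le> k \<and> l k (replicate k \<alpha>) \<noteq> 0}.
        scale ((-1) ^ ((k - 1) choose 2) / fact k) (l k (replicate k \<alpha>))) = 0"

lemma maurer_cartan_l2_l3:
  assumes "vector_space scale" and zero: "\<And>k xs. k \<noteq> 2 \<Longrightarrow> k \<noteq> 3 \<Longrightarrow> l k xs = 0"
  shows "maurer_cartan scale L l \<alpha> \<longleftrightarrow>
    \<alpha> \<in> L 1 \<and> scale (1 / 2) (l 2 [\<alpha>, \<alpha>]) - scale (1 / 6) (l 3 [\<alpha>, \<alpha>, \<alpha>]) = 0"
proof -
  interpret vector_space scale by fact
  let ?S = "{k. 1 \<le> k \<and> l k (replicate k \<alpha>) \<noteq> 0}"
  let ?f = "\<lambda>k. scale ((-1) ^ ((k - 1) choose 2) / fact k) (l k (replicate k \<alpha>))"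
  have sub: "?S \<subseteq> {2, 3}" using zero by blast
  have "sum ?f ?S = sum ?f {2, 3}"
    by (rule sum.mono_neutral_left) (use sub in auto)
  also have "\<dots> = scale (1 / 2) (l 2 [\<alpha>, \<alpha>]) - scale (1 / 6) (l 3 [\<alpha>, \<alpha>, \<alpha>])"
    by (simp add: numeral_eq_Suc scale_minus_left)
  finally show ?thesis
    using finite_subset[OF sub] by (simp add: maurer_cartan_def)
qed


section \<open>Lie algebras and Reynolds operators\<close>

locale lie_algebra = vector_space scale
  for scale :: "'k::field \<Rightarrow> 'g::ab_group_add \<Rightarrow> 'g" +
  fixes bracket :: "'g \<Rightarrow> 'g \<Rightarrow> 'g"
  assumes bracket_add_left: "bracket (x + y) z = bracket x z + bracket y z"
    and bracket_add_right: "bracket x (y + z) = bracket x y + bracket x z"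
    and bracket_scale_left: "bracket (scale c x) y = scale c (bracket x y)"
    and bracket_scale_right: "bracket x (scale c y) = scale c (bracket x y)"
    and bracket_self: "bracket x x = 0"
    and jacobi: "bracket x (bracket y z) + bracket y (bracket z x) + bracket z (bracket x y) = 0"

definition reynolds_operator ::
  "('k::field \<Rightarrow> 'g::ab_group_add \<Rightarrow> 'g) \<Rightarrow> ('g \<Rightarrow> 'g \<Rightarrow> 'g) \<Rightarrow> ('g \<Rightarrow> 'g) \<Rightarrow> bool"
where
  "reynolds_operator scale bracket R \<longleftrightarrow> Vector_Spaces.linear scale scale R \<and>
     (\<forall>x y. bracket (R x) (R y) =
        R (bracket (R x) y + bracket x (R y) - bracket (R x) (R y)))"


section \<open>The graded space of alternating maps\<close>

text \<open>
  A linear map from the n-th exterior power of M to \<open>\<gg>\<close> is given as the corresponding alternating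
  n-linear map, extended by zero to the lists of length other than n.  In this way all cochains
  live in one function type, the maps of different degrees are linearly independent, and the
  component of degree n of a sum of cochains is its restriction to the lists of length n.
\<close>

definition Hom_wedge ::
  "('k \<Rightarrow> 'm::ab_group_add \<Rightarrow> 'm) \<Rightarrow> ('k \<Rightarrow> 'g::ab_group_add \<Rightarrow> 'g) \<Rightarrow> nat \<Rightarrow> ('m list \<Rightarrow> 'g) set"
where
  "Hom_wedge sm sg n = {P. multilinear_on sm sg UNIV n P \<and>
     (\<forall>us. length us = n \<and> \<not> distinct us \<longrightarrow> P us = 0) \<and>
     (\<forall>us. length us \<noteq> n \<longrightarrow> P us = 0)}"

definition cochains ::
  "('k \<Rightarrow> 'g::ab_group_add \<Rightarrow> 'g) \<Rightarrow> int \<Rightarrow> ('g list \<Rightarrow> 'g) set"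
where
  "cochains scale n = (if 0 \<le> n then Hom_wedge scale scale (nat n) else {0})"

definition cochain_scale ::
  "('k \<Rightarrow> 'g \<Rightarrow> 'g) \<Rightarrow> 'k \<Rightarrow> ('m list \<Rightarrow> 'g) \<Rightarrow> ('m list \<Rightarrow> 'g)"
where
  "cochain_scale scale c P = (\<lambda>us. scale c (P us))"

definition component :: "nat \<Rightarrow> ('m list \<Rightarrow> 'g::zero) \<Rightarrow> ('m list \<Rightarrow> 'g)" where
  "component n P = (\<lambda>us. if length us = n then P us else 0)"

definition linear_cochain :: "('m \<Rightarrow> 'g::zero) \<Rightarrow> ('m list \<Rightarrow> 'g)" where
  "linear_cochain R = (\<lambda>us. if length us = 1 then R (us ! 0) else 0)"


section \<open>The brackets\<close>

definition block :: "'m list \<Rightarrow> (nat \<Rightarrow> nat) \<Rightarrow> nat \<Rightarrow> nat \<Rightarrow> 'm list" where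
  "block us \<sigma> a b = map (\<lambda>i. us ! \<sigma> i) [a..<b]"

text \<open>\<open>insert_action \<dots> p P q Q\<close> is the sum over Sh(q, 1, p - 1) in which the value of Q acts on one
  argument and the result is inserted into P.\<close>

definition insert_action ::
  "('k::field \<Rightarrow> 'g::ab_group_add \<Rightarrow> 'g) \<Rightarrow> ('g \<Rightarrow> 'm \<Rightarrow> 'm) \<Rightarrow>
   nat \<Rightarrow> ('m list \<Rightarrow> 'g) \<Rightarrow> nat \<Rightarrow> ('m list \<Rightarrow> 'g) \<Rightarrow> 'm list \<Rightarrow> 'g"
where
  "insert_action scale act p P q Q us = (\<Sum>\<sigma>\<in>Sh3 q 1 (int p - 1).
     scale (of_int (sign \<sigma>))
       (P (act (Q (block us \<sigma> 0 q)) (us ! \<sigma> q) # block us \<sigma> (q + 1) (p + q))))"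

definition hom_bracket2 ::
  "('k::field \<Rightarrow> 'g::ab_group_add \<Rightarrow> 'g) \<Rightarrow> ('g \<Rightarrow> 'g \<Rightarrow> 'g) \<Rightarrow> ('g \<Rightarrow> 'm \<Rightarrow> 'm) \<Rightarrow>
   nat \<Rightarrow> ('m list \<Rightarrow> 'g) \<Rightarrow> nat \<Rightarrow> ('m list \<Rightarrow> 'g) \<Rightarrow> 'm list \<Rightarrow> 'g"
where
  "hom_bracket2 scale bracket act p P q Q us =
     insert_action scale act p P q Q us
     - scale ((-1) ^ (p * q)) (insert_action scale act q Q p P us)
     + scale ((-1) ^ (p * q)) (\<Sum>\<sigma>\<in>Sh2 p q. scale (of_int (sign \<sigma>))
         (bracket (P (block us \<sigma> 0 p)) (Q (block us \<sigma> p (p + q)))))"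

text \<open>\<open>insert_cocycle \<dots> p P q Q r R\<close> is the sum over Sh(q, r, p - 1) in which the values of Q and R
  are inserted into H and the result into P.\<close>

definition insert_cocycle ::
  "('k::field \<Rightarrow> 'g::ab_group_add \<Rightarrow> 'g) \<Rightarrow> ('g \<Rightarrow> 'g \<Rightarrow> 'm) \<Rightarrow>
   nat \<Rightarrow> ('m list \<Rightarrow> 'g) \<Rightarrow> nat \<Rightarrow> ('m list \<Rightarrow> 'g) \<Rightarrow> nat \<Rightarrow> ('m list \<Rightarrow> 'g) \<Rightarrow> 'm list \<Rightarrow> 'g"
where
  "insert_cocycle scale H p P q Q r R us = (\<Sum>\<sigma>\<in>Sh3 q r (int p - 1).
     scale (of_int (sign \<sigma>))
       (P (H (Q (block us \<sigma> 0 q)) (R (block us \<sigma> q (q + r))) # block us \<sigma> (q + r) (p + q + r - 1))))"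

text \<open>
  The sign in front of the two terms of the ternary bracket in which P is the outer map.  It
  deliberately replaces a common factor \<open>(-1)^(p * q * r)\<close> in front of all six terms, found in the
  source of this formula.  The two agree for an outer map of odd degree, in particular in the
  Maurer-Cartan equation, but for an outer map of even degree the common factor breaks the higher
  Jacobi identities:  in the adjoint case with \<open>H = -\<mu>\<close>, if a and b have degree 0 and id is the
  identity of \<open>\<gg>\<close>, in degree 1, then with the common factor the left-hand side of the identity for
  (a, b, id, id) is \<open>u \<mapsto> -4 [[a, b], u]\<close>.
\<close>

definition outer_sign :: "nat \<Rightarrow> nat \<Rightarrow> nat \<Rightarrow> 'k::field" where
  "outer_sign p q r = (-1) ^ (p + 1 + q * r)"

definition hom_bracket3 ::
  "('k::field \<Rightarrow> 'g::ab_group_add \<Rightarrow> 'g) \<Rightarrow> ('g \<Rightarrow> 'g \<Rightarrow> 'm) \<Rightarrow>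
   nat \<Rightarrow> ('m list \<Rightarrow> 'g) \<Rightarrow> nat \<Rightarrow> ('m list \<Rightarrow> 'g) \<Rightarrow> nat \<Rightarrow> ('m list \<Rightarrow> 'g) \<Rightarrow> 'm list \<Rightarrow> 'g"
where
  "hom_bracket3 scale H p P q Q r R us = scale (1 / 2)
     (scale (outer_sign p q r) (insert_cocycle scale H p P q Q r R us)
      - scale (outer_sign p q r * (-1) ^ (q * r)) (insert_cocycle scale H p P r R q Q us)
      - scale (outer_sign q p r * (-1) ^ (p * q)) (insert_cocycle scale H q Q p P r R us)
      + scale (outer_sign q p r * (-1) ^ (p * (q + r))) (insert_cocycle scale H q Q r R p P us)
      + scale (outer_sign r p q * (-1) ^ ((p + q) * r)) (insert_cocycle scale H r R p P q Q us)
      - scale (outer_sign r p q * (-1) ^ (p * q + q * r + r * p))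
          (insert_cocycle scale H r R q Q p P us))"

text \<open>
  The bilinear and trilinear extensions to sums of homogeneous elements.  On lists of length n
  only the components with \<open>p + q = n\<close>, respectively \<open>p + q + r - 1 = n\<close>, contribute, so that
  the sums over all degrees are finite.
\<close>

definition bracket2 ::
  "('k::field \<Rightarrow> 'g::ab_group_add \<Rightarrow> 'g) \<Rightarrow> ('g \<Rightarrow> 'g \<Rightarrow> 'g) \<Rightarrow> ('g \<Rightarrow> 'm \<Rightarrow> 'm) \<Rightarrow>
   ('m list \<Rightarrow> 'g) \<Rightarrow> ('m list \<Rightarrow> 'g) \<Rightarrow> 'm list \<Rightarrow> 'g"
where
  "bracket2 scale bracket act P Q = (\<lambda>us. \<Sum>(p, q)\<in>{(p, q). p + q = length us}.
     hom_bracket2 scale bracket act p (component p P) q (component q Q) us)"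

definition bracket3 ::
  "('k::field \<Rightarrow> 'g::ab_group_add \<Rightarrow> 'g) \<Rightarrow> ('g \<Rightarrow> 'g \<Rightarrow> 'm) \<Rightarrow>
   ('m list \<Rightarrow> 'g) \<Rightarrow> ('m list \<Rightarrow> 'g) \<Rightarrow> ('m list \<Rightarrow> 'g) \<Rightarrow> 'm list \<Rightarrow> 'g"
where
  "bracket3 scale H P Q R = (\<lambda>us. \<Sum>(p, q, r)\<in>{(p, q, r). p + q + r = length us + 1}.
     hom_bracket3 scale H p (component p P) q (component q Q) r (component r R) us)"

text \<open>The case of the adjoint module and the 2-cocycle \<open>H = -\<mu>\<close>.\<close>

definition reynolds_maps ::
  "('k::field \<Rightarrow> 'g::ab_group_add \<Rightarrow> 'g) \<Rightarrow> ('g \<Rightarrow> 'g \<Rightarrow> 'g) \<Rightarrow>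
   nat \<Rightarrow> ('g list \<Rightarrow> 'g) list \<Rightarrow> ('g list \<Rightarrow> 'g)"
where
  "reynolds_maps scale \<mu> k xs =
     (if k = 2 then bracket2 scale \<mu> \<mu> (xs ! 0) (xs ! 1)
      else if k = 3 then bracket3 scale (\<lambda>x y. - \<mu> x y) (xs ! 0) (xs ! 1) (xs ! 2)
      else 0)"

end

theory Submission
  imports Defs
begin

text \<open>
  Fix a tuple of arguments.  An alternating map assigns a value to each subtuple, so alternating
  maps multiply like elements of the exterior algebra with coefficients in \<open>\<gg>\<close>:  \<open>conv\<close> is the
  graded Lie product induced by the bracket, and \<open>ins X P\<close> is the derivation \<open>D\<^sub>X P\<close> that inserts X
  into one argument of P.  Contraction with a vector is a derivation of both operations, whence by
  induction on the arguments \<open>conv\<close> satisfies the graded Jacobi identity, \<open>D\<^sub>X\<close> is a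
  derivation of \<open>conv\<close>, and \<open>D\<close> is graded pre-Lie:
  \<open>D\<^sub>X D\<^sub>Y \<mp> D\<^sub>Y D\<^sub>X\<close> is insertion of \<open>D\<^sub>X Y \<mp> D\<^sub>Y X\<close>.
  With e the identity of \<open>\<gg>\<close>, which satisfies
  \<open>D\<^sub>X e = X\<close>, the binary bracket is
  \<open>D\<^bsub>[Q, e]\<^esub> P \<mp> D\<^bsub>[P, e]\<^esub> Q \<plusminus> [P, Q]\<close>, and the ternary bracket is the signed sum of
  \<open>D\<^bsub>[Q, R]\<^esub> P\<close> over the three choices of the outer map.  The higher Jacobi identities, which are
  nontrivial for 3, 4 and 5 arguments only, are formal consequences of these laws, and they see
  only the parities of the degrees.
\<close>

section \<open>Permutations with a prescribed zero\<close>

text \<open>Composite brackets written with permutations would require regrouping shuffles of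
  shuffles. This is avoided by turning every shuffle sum, once, into a recursion on the argument
  list, according to the block that receives the first argument. Contraction with that argument is
  then one step of the recursion, so each law has to be checked directly on the empty list only. The
  same recursion, with Koszul signs, unfolds the unshuffle sums of the axioms over a list of three
  to five labels into explicit sums. The identity cochain enters because its one argument supplies
  the middle block of size one in the action terms; binary and ternary bracket thus need only one
  kind of insertion, that of a product. As signs depend on parities alone, each higher Jacobi
  identity splits into at most 32 cases, in which the laws, oriented as rewrite rules, bring all
  terms to a normal form.\<close>

definition ext_perm :: "nat \<Rightarrow> (nat \<Rightarrow> nat) \<Rightarrow> nat \<Rightarrow> nat" where
  "ext_perm m \<sigma> i = (if i < m then Suc (\<sigma> i) else if i = m then 0 else Suc (\<sigma> (i - 1)))"

text \<open>The increasing enumeration of the positions other than \<open>m\<close>. Through it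
  \<open>ext_perm m \<sigma>\<close> reads as \<open>\<sigma>\<close> with all values raised by one
  and the value 0 inserted at position \<open>m\<close>, where the first argument then
  stands.\<close>

definition skip :: "nat \<Rightarrow> nat \<Rightarrow> nat" where
  "skip m i = (if i < m then i else Suc i)"

lemma skip_inj: "skip m i = skip m j \<longleftrightarrow> i = j"
  by (auto simp: skip_def)

lemma skip_less: "skip m i < skip m j \<longleftrightarrow> i < j"
  by (auto simp: skip_def)

lemma skip_neq: "skip m i \<noteq> m"
  by (auto simp: skip_def)

lemma skip_cases: obtains "i = m" | j where "i = skip m j"
proof (cases i m rule: linorder_cases)
  case less
  then show ?thesis by (intro that(2)[of i]) (auto simp: skip_def)
next
  case greater
  then show ?thesis by (intro that(2)[of "i - 1"]) (auto simp: skip_def)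
qed (use that in auto)

lemma ext_perm_at [simp]: "ext_perm m \<sigma> m = 0"
  by (simp add: ext_perm_def)

lemma ext_perm_skip [simp]: "ext_perm m \<sigma> (skip m i) = Suc (\<sigma> i)"
  by (auto simp: ext_perm_def skip_def)

lemma inj_ext_perm: "inj (ext_perm m)"
  by (rule injI, rule ext) (metis ext_perm_skip nat.inject)

lemma ext_perm_permutes:
  assumes "\<sigma> permutes {..<n}" "m \<le> n"
  shows "ext_perm m \<sigma> permutes {..<Suc n}"
proof (rule inj_imp_permutes)
  have inj: "\<sigma> i = \<sigma> j \<longleftrightarrow> i = j" for i j
    using permutes_inj[OF assms(1)] by (auto dest: injD)
  show "inj_on (ext_perm m \<sigma>) {..<Suc n}"
  proof (rule inj_onI)
    fix i j assume "ext_perm m \<sigma> i = ext_perm m \<sigma> j"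
    then show "i = j"
      by (cases i m rule: skip_cases; cases j m rule: skip_cases) (auto simp: inj)
  qed
  show "ext_perm m \<sigma> i \<in> {..<Suc n}" if "i \<in> {..<Suc n}" for i
  proof (cases i m rule: skip_cases)
    case (2 j)
    then have "j < n" using that assms(2) by (auto simp: skip_def split: if_splits)
    then show ?thesis using 2 permutes_in_image[OF assms(1), of j] by auto
  qed simp
  show "ext_perm m \<sigma> i = i" if "i \<notin> {..<Suc n}" for i
    using that assms(2) permutes_not_in[OF assms(1), of "i - 1"] by (auto simp: ext_perm_def)
qed simp

lemma ext_perm_surj:
  assumes "\<tau> permutes {..<Suc n}" "m \<le> n" "\<tau> m = 0"
  obtains \<sigma> where "\<sigma> permutes {..<n}" "\<tau> = ext_perm m \<sigma>"
proof
  \<comment> \<open>Position \<open>m\<close> and value 0 are deleted. Injectivity makes the value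
    at every other position positive, so the subtraction is not truncated.\<close>
  define \<sigma> where "\<sigma> = (\<lambda>j. \<tau> (skip m j) - 1)"
  have inj: "\<tau> i = \<tau> j \<longleftrightarrow> i = j" for i j
    using permutes_inj[OF assms(1)] by (auto dest: injD)
  have pos: "\<tau> (skip m j) = Suc (\<sigma> j)" for j
    using inj[of "skip m j" m] skip_neq[of m j] assms(3) by (simp add: \<sigma>_def)
  show "\<tau> = ext_perm m \<sigma>"
  proof
    fix i show "\<tau> i = ext_perm m \<sigma> i"
      by (cases i m rule: skip_cases) (auto simp: pos assms(3))
  qed
  show "\<sigma> permutes {..<n}"
  proof (rule inj_imp_permutes)
    show "inj_on \<sigma> {..<n}"
      by (rule inj_onI) (metis pos inj skip_inj)
    show "\<sigma> i \<in> {..<n}" if "i \<in> {..<n}" for i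
      using permutes_in_image[OF assms(1), of "skip m i"] pos[of i] that
      by (auto simp: skip_def split: if_splits)
    show "\<sigma> i = i" if "i \<notin> {..<n}" for i
      using permutes_not_in[OF assms(1), of "Suc i"] pos[of i] that assms(2)
      by (auto simp: skip_def)
  qed simp
qed

text \<open>Moving the value 0 from the front to position \<open>m\<close> takes \<open>m\<close>
  adjacent transpositions.\<close>

lemma sign_ext_perm:
  assumes "\<sigma> permutes {..<n}" "m \<le> n"
  shows "sign (ext_perm m \<sigma>) = (-1) ^ m * sign \<sigma>"
  using assms(2)
proof (induction m)
  case 0
  \<comment> \<open>With 0 in front, the permutation is \<open>\<sigma>\<close> transported along
    \<open>Suc\<close>, which preserves the sign.\<close>
  have "ext_perm 0 \<sigma> = map_permutation {..<n} Suc \<sigma>"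
  proof
    fix i show "ext_perm 0 \<sigma> i = map_permutation {..<n} Suc \<sigma> i"
    proof (cases "i \<in> Suc ` {..<n}")
      case True
      then show ?thesis by (auto simp: map_permutation_apply ext_perm_def)
    next
      case False
      have "i = 0 \<or> \<sigma> (i - 1) = i - 1"
      proof (cases i)
        case (Suc j)
        with False have "j \<notin> {..<n}" by auto
        then show ?thesis using permutes_not_in[OF assms(1)] Suc by simp
      qed simp
      then show ?thesis using False
        by (auto simp: ext_perm_def map_permutation_def restrict_id_def)
    qed
  qed
  then show ?case by (simp add: sign_map_permutation assms(1))
next
  case (Suc m)
  have eq: "ext_perm (Suc m) \<sigma> = ext_perm m \<sigma> \<circ> transpose m (Suc m)"
    by (rule ext) (auto simp: ext_perm_def transpose_def)
  have "permutation (ext_perm m \<sigma>)"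
    using ext_perm_permutes[OF assms(1), of m] Suc.prems by (meson finite_lessThan permutation_permutes Suc_leD)
  then have "sign (ext_perm (Suc m) \<sigma>) = sign (ext_perm m \<sigma>) * sign (transpose m (Suc m))"
    unfolding eq by (rule sign_compose) (rule permutation_swap_id)
  then show ?case
    using Suc by (simp add: sign_swap_id)
qed

text \<open>The value 0 at position \<open>m\<close> forms inversions with exactly the positions
  before \<open>m\<close>; all other inversions are those of \<open>\<sigma>\<close>, carried along
  by \<open>skip m\<close>.\<close>

lemma koszul_sign_ext_perm:
  assumes "m \<le> n"
  shows "koszul_sign (Suc n) d (ext_perm m \<sigma>) =
    (\<Prod>i<m. if even (d (Suc (\<sigma> i)) * d 0) then 1 else -1) * koszul_sign n (\<lambda>i. d (Suc i)) \<sigma>"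
proof -
  let ?f = "\<lambda>(i, j). if even (d (ext_perm m \<sigma> i) * d (ext_perm m \<sigma> j)) then 1 else (-1::int)"
  let ?inv = "{(i, j). i < j \<and> j < Suc n \<and> ext_perm m \<sigma> j < ext_perm m \<sigma> i}"
  let ?A = "(\<lambda>i. (i, m)) ` {..<m}"
  let ?inv' = "{(i, j). i < j \<and> j < n \<and> \<sigma> j < \<sigma> i}"
  let ?B = "map_prod (skip m) (skip m) ` ?inv'"
  have "?inv = ?A \<union> ?B"
  proof (intro equalityI subsetI)
    fix p assume p: "p \<in> ?inv"
    obtain i j where ij: "p = (i, j)" by (cases p)
    show "p \<in> ?A \<union> ?B"
    proof (cases j m rule: skip_cases)
      case 1 then show ?thesis using p ij by auto
    next
      case (2 j')
      then obtain i' where i': "i = skip m i'"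
        using p ij by (cases i m rule: skip_cases) auto
      have "j' < n" using 2 p ij assms by (auto simp: skip_def split: if_splits)
      then have "(i', j') \<in> ?inv'" using p ij 2 i' by (auto simp: skip_less)
      then show ?thesis using ij 2 i' by (intro UnI2 rev_image_eqI[of "(i', j')"]) auto
    qed
  next
    fix p assume "p \<in> ?A \<union> ?B"
    then show "p \<in> ?inv"
    proof
      assume "p \<in> ?A"
      then show ?thesis using assms by (auto simp: ext_perm_def)
    next
      assume "p \<in> ?B"
      moreover have "j < n \<Longrightarrow> skip m j < Suc n" for j by (auto simp: skip_def)
      ultimately show ?thesis by (auto simp: skip_less)
    qed
  qed
  moreover have "?A \<inter> ?B = {}" by (auto simp: skip_neq)
  moreover have fin: "finite ?inv'"
    by (rule finite_subset[of _ "{..<n} \<times> {..<n}"]) auto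
  ultimately have "koszul_sign (Suc n) d (ext_perm m \<sigma>) = prod ?f ?A * prod ?f ?B"
    unfolding koszul_sign_def by (simp add: prod.union_disjoint)
  also have "prod ?f ?A = (\<Prod>i<m. if even (d (Suc (\<sigma> i)) * d 0) then 1 else -1)"
    by (subst prod.reindex) (auto simp: inj_on_def ext_perm_def intro!: prod.cong)
  also have "prod ?f ?B = koszul_sign n (\<lambda>i. d (Suc i)) \<sigma>"
    unfolding koszul_sign_def
    by (subst prod.reindex) (auto simp: inj_on_def skip_inj intro!: prod.cong)
  finally show ?thesis .
qed

section \<open>Sums over shuffles as recursive unshuffle sums\<close>

text \<open>Signs are encoded by booleans, true meaning odd, so that \<open>s \<noteq> t\<close> is the sum of two parities.\<close>

definition neg_if :: "bool \<Rightarrow> 'b::ab_group_add \<Rightarrow> 'b" where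
  "neg_if s x = (if s then - x else x)"

lemma neg_if_simps [simp]:
  "neg_if False x = x" "neg_if True x = - x" "neg_if s 0 = 0"
  "neg_if s (neg_if t x) = neg_if (s \<noteq> t) x"
  by (auto simp: neg_if_def)

text \<open>The sign of moving \<open>u\<close> past \<open>xs\<close> under graded antisymmetry:
  every entry passed contributes -1 from the signature and its Koszul sign.\<close>

definition swap_parity :: "('a \<Rightarrow> int) \<Rightarrow> 'a \<Rightarrow> 'a list \<Rightarrow> bool" where
  "swap_parity d u xs \<longleftrightarrow> odd (int (length xs) + d u * sum_list (map d xs))"

text \<open>All block sizes are summed at once; \<open>only_if\<close> selects the wanted ones
  later. The earliest argument can only become the head of its block, because blocks are increasing,
  and the sign is that of moving it past the members of the preceding blocks.\<close>

primrec unshuffle3 ::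
  "('a \<Rightarrow> int) \<Rightarrow> 'a list \<Rightarrow> ('a list \<Rightarrow> 'a list \<Rightarrow> 'a list \<Rightarrow> 'b::ab_group_add) \<Rightarrow> 'b"
where
  "unshuffle3 d [] F = F [] [] []"
| "unshuffle3 d (u # us) F =
     unshuffle3 d us (\<lambda>xs ys zs. F (u # xs) ys zs)
     + unshuffle3 d us (\<lambda>xs ys zs. neg_if (swap_parity d u xs) (F xs (u # ys) zs))
     + unshuffle3 d us (\<lambda>xs ys zs. neg_if (swap_parity d u (xs @ ys)) (F xs ys (u # zs)))"

lemma unshuffle3_zero [simp]: "unshuffle3 d us (\<lambda>xs ys zs. 0) = 0"
  by (induction us) auto

definition only_if :: "bool \<Rightarrow> 'b::zero \<Rightarrow> 'b" where
  "only_if P x = (if P then x else 0)"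

lemma neg_if_only_if: "neg_if s (only_if P x) = only_if P (neg_if s x)"
  by (simp add: only_if_def)

text \<open>The power of -1 comes from \<open>sign_ext_perm\<close>, the product from
  \<open>koszul_sign_ext_perm\<close>.\<close>

lemma swap_parity_prod:
  "(-1) ^ m * (\<Prod>i<m. if even (d (us ! \<sigma> i) * d u) then 1 else - 1) =
    (if swap_parity d u (map (\<lambda>i. us ! \<sigma> i) [0..<m]) then -1 else (1::int))"
  by (induction m) (auto simp: swap_parity_def algebra_simps)

lemma block_ext_perm:
  "hi \<le> m \<Longrightarrow> block (u # us) (ext_perm m \<sigma>) lo hi = block us \<sigma> lo hi"
  "block (u # us) (ext_perm m \<sigma>) m (Suc (m + k)) = u # block us \<sigma> m (m + k)"
  "m < Suc lo \<Longrightarrow> block (u # us) (ext_perm m \<sigma>) (Suc lo) (Suc hi) = block us \<sigma> lo hi"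
proof -
  have Suc_map: "map f [Suc l..<Suc h] = map (\<lambda>i. f (Suc i)) [l..<h]" for f :: "nat \<Rightarrow> 'c" and l h
    by (simp only: map_Suc_upt[symmetric] map_map comp_def)
  show "hi \<le> m \<Longrightarrow> block (u # us) (ext_perm m \<sigma>) lo hi = block us \<sigma> lo hi"
    by (simp add: block_def ext_perm_def)
  show *: "m < Suc lo \<Longrightarrow> block (u # us) (ext_perm m \<sigma>) (Suc lo) (Suc hi) = block us \<sigma> lo hi" for lo hi
    unfolding block_def Suc_map by (simp add: ext_perm_def)
  have "block (u # us) (ext_perm m \<sigma>) m (Suc (m + k)) = u # block (u # us) (ext_perm m \<sigma>) (Suc m) (Suc (m + k))"
    unfolding block_def by (subst upt_conv_Cons) auto
  then show "block (u # us) (ext_perm m \<sigma>) m (Suc (m + k)) = u # block us \<sigma> m (m + k)"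
    by (simp add: *)
qed

lemma strict_mono_on_interval:
  "strict_mono_on {lo..<hi::nat} f \<longleftrightarrow> (\<forall>i j. lo \<le> i \<longrightarrow> i < j \<longrightarrow> j < hi \<longrightarrow> f i < f j)"
  by (force simp: strict_mono_on_def)

lemma strict_mono_on_ext_perm:
  fixes \<sigma> :: "nat \<Rightarrow> nat"
  shows "hi \<le> m \<Longrightarrow> strict_mono_on {lo..<hi} (ext_perm m \<sigma>) \<longleftrightarrow> strict_mono_on {lo..<hi} \<sigma>"
    and "strict_mono_on {m..<Suc (m + k)} (ext_perm m \<sigma>) \<longleftrightarrow> strict_mono_on {m..<m + k} \<sigma>"
    and "m < Suc lo \<Longrightarrow> strict_mono_on {Suc lo..<Suc hi} (ext_perm m \<sigma>) \<longleftrightarrow> strict_mono_on {lo..<hi} \<sigma>"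
proof -
  show "hi \<le> m \<Longrightarrow> strict_mono_on {lo..<hi} (ext_perm m \<sigma>) \<longleftrightarrow> strict_mono_on {lo..<hi} \<sigma>"
    by (auto simp: strict_mono_on_interval ext_perm_def)
  show *: "strict_mono_on {Suc lo..<Suc hi} (ext_perm m \<sigma>) \<longleftrightarrow> strict_mono_on {lo..<hi} \<sigma>"
    if "m < Suc lo" for lo hi
    unfolding strict_mono_on_interval
  proof (intro iffI allI impI)
    fix i j assume "\<forall>i j. Suc lo \<le> i \<longrightarrow> i < j \<longrightarrow> j < Suc hi \<longrightarrow> ext_perm m \<sigma> i < ext_perm m \<sigma> j"
      and "lo \<le> i" "i < j" "j < hi"
    from this(1)[rule_format, of "Suc i" "Suc j"] this(2-) that show "\<sigma> i < \<sigma> j"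
      by (simp add: ext_perm_def)
  next
    fix i j assume "\<forall>i j. lo \<le> i \<longrightarrow> i < j \<longrightarrow> j < hi \<longrightarrow> \<sigma> i < \<sigma> j"
      and "Suc lo \<le> i" "i < j" "j < Suc hi"
    from this(1)[rule_format, of "i - 1" "j - 1"] this(2-) that
    show "ext_perm m \<sigma> i < ext_perm m \<sigma> j"
      by (simp add: ext_perm_def)
  qed
  have "strict_mono_on {m..<Suc (m + k)} (ext_perm m \<sigma>) \<longleftrightarrow>
      strict_mono_on {Suc m..<Suc (m + k)} (ext_perm m \<sigma>)"
    unfolding strict_mono_on_interval
  proof (intro iffI allI impI)
    fix i j assume "\<forall>i j. Suc m \<le> i \<longrightarrow> i < j \<longrightarrow> j < Suc (m + k) \<longrightarrow> ext_perm m \<sigma> i < ext_perm m \<sigma> j"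
      and "m \<le> i" "i < j" "j < Suc (m + k)"
    then show "ext_perm m \<sigma> i < ext_perm m \<sigma> j"
      by (cases "i = m") (simp_all add: ext_perm_def)
  qed simp
  then show "strict_mono_on {m..<Suc (m + k)} (ext_perm m \<sigma>) \<longleftrightarrow> strict_mono_on {m..<m + k} \<sigma>"
    by (simp add: *)
qed

section \<open>Shuffles classified by the block that receives the first argument\<close>

lemma Sh3_nat: "Sh3 a b (int c) = {\<sigma>. \<sigma> permutes {..<a + b + c} \<and>
     strict_mono_on {0..<a} \<sigma> \<and> strict_mono_on {a..<a + b} \<sigma> \<and>
     strict_mono_on {a + b..<a + b + c} \<sigma>}"
  by (simp add: Sh3_def lessThan_atLeast0)

text \<open>The recursion for three blocks thus serves both kinds of shuffles.\<close>

lemma Sh2_eq_Sh3: "Sh2 a b = Sh3 a b (int 0)"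
  unfolding Sh3_nat by (auto simp: Sh2_def lessThan_atLeast0 strict_mono_on_def)

lemma finite_Sh3: "finite (Sh3 a b (int c))"
  unfolding Sh3_nat by (rule finite_subset[OF _ finite_permutations[of "{..<a + b + c}"]]) auto

lemma Sh3_ext_perm:
  "{\<sigma> \<in> Sh3 (Suc a) b (int c). \<sigma> 0 = 0} = ext_perm 0 ` Sh3 a b (int c)"
  "{\<sigma> \<in> Sh3 a (Suc b) (int c). \<sigma> a = 0} = ext_perm a ` Sh3 a b (int c)"
  "{\<sigma> \<in> Sh3 a b (int (Suc c)). \<sigma> (a + b) = 0} = ext_perm (a + b) ` Sh3 a b (int c)"
proof -
  have key: "{\<sigma> \<in> {\<sigma>. \<sigma> permutes {..<Suc n} \<and> P \<sigma>}. \<sigma> m = 0} = ext_perm m ` {\<sigma>. \<sigma> permutes {..<n} \<and> Q \<sigma>}"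
    if m: "m \<le> n" and "\<And>\<sigma>. P (ext_perm m \<sigma>) \<longleftrightarrow> Q \<sigma>" for m n P Q
  proof (intro equalityI subsetI)
    fix \<tau> assume t: "\<tau> \<in> {\<sigma> \<in> {\<sigma>. \<sigma> permutes {..<Suc n} \<and> P \<sigma>}. \<sigma> m = 0}"
    then have "\<tau> permutes {..<Suc n}" "\<tau> m = 0" by auto
    then obtain \<sigma> where "\<sigma> permutes {..<n}" "\<tau> = ext_perm m \<sigma>"
      by (rule ext_perm_surj[OF _ m])
    with t that(2) show "\<tau> \<in> ext_perm m ` {\<sigma>. \<sigma> permutes {..<n} \<and> Q \<sigma>}" by auto
  qed (use that ext_perm_permutes in auto)
  note s = strict_mono_on_ext_perm
  show "{\<sigma> \<in> Sh3 (Suc a) b (int c). \<sigma> 0 = 0} = ext_perm 0 ` Sh3 a b (int c)"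
    unfolding Sh3_nat add_Suc
    by (rule key) (simp_all add: s(2)[of 0, simplified] s(3))
  show "{\<sigma> \<in> Sh3 a (Suc b) (int c). \<sigma> a = 0} = ext_perm a ` Sh3 a b (int c)"
    unfolding Sh3_nat add_Suc add_Suc_right
    by (rule key) (simp_all add: s)
  show "{\<sigma> \<in> Sh3 a b (int (Suc c)). \<sigma> (a + b) = 0} = ext_perm (a + b) ` Sh3 a b (int c)"
    unfolding Sh3_nat add_Suc add_Suc_right
    by (rule key) (simp_all add: s)
qed

text \<open>Increasing blocks force the index 0 to the start of one of the three blocks; removing it
  leaves a shuffle of the remaining arguments.\<close>

lemma sum_Sh3_Suc:
  assumes n: "a + b + c = Suc n"
  shows "(\<Sum>\<sigma>\<in>Sh3 a b (int c). f \<sigma> :: 'b::ab_group_add) =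
    (case a of 0 \<Rightarrow> 0 | Suc a' \<Rightarrow> \<Sum>\<sigma>\<in>Sh3 a' b (int c). f (ext_perm 0 \<sigma>))
    + (case b of 0 \<Rightarrow> 0 | Suc b' \<Rightarrow> \<Sum>\<sigma>\<in>Sh3 a b' (int c). f (ext_perm a \<sigma>))
    + (case c of 0 \<Rightarrow> 0 | Suc c' \<Rightarrow> \<Sum>\<sigma>\<in>Sh3 a b (int c'). f (ext_perm (a + b) \<sigma>))"
proof -
  let ?S = "Sh3 a b (int c)"
  \<comment> \<open>Without the size conditions an empty block would share its start with the next
    block, and a shuffle could be counted twice.\<close>
  let ?A = "{\<sigma> \<in> ?S. 0 < a \<and> \<sigma> 0 = 0}"
  let ?B = "{\<sigma> \<in> ?S. 0 < b \<and> \<sigma> a = 0}"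
  let ?C = "{\<sigma> \<in> ?S. 0 < c \<and> \<sigma> (a + b) = 0}"
  have "?S \<subseteq> ?A \<union> ?B \<union> ?C"
  proof
    fix \<sigma> assume \<sigma>: "\<sigma> \<in> ?S"
    then have p: "\<sigma> permutes {..<a + b + c}" by (simp add: Sh3_nat)
    then obtain m where m: "\<sigma> m = 0" "m < a + b + c"
      using n by (metis permutes_def lessThan_iff zero_less_Suc)
    have mono: "\<sigma> lo < \<sigma> m" if "lo < m" "lo = 0 \<and> m < a \<or> lo = a \<and> m < a + b \<or> lo = a + b" for lo
      using \<sigma> that m(2) unfolding Sh3_nat strict_mono_on_interval by blast
    consider "m < a" | "a \<le> m" "m < a + b" | "a + b \<le> m" by linarith
    then show "\<sigma> \<in> ?A \<union> ?B \<union> ?C"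
    proof cases
      case 1
      then have "m = 0" using mono[of 0] m(1) by auto
      then show ?thesis using \<sigma> m 1 by auto
    next
      case 2
      then have "m = a" using mono[of a] m(1) by (cases "a = m") auto
      then show ?thesis using \<sigma> m 2 by auto
    next
      case 3
      then have "m = a + b" using mono[of "a + b"] m(1) by (cases "a + b = m") auto
      then show ?thesis using \<sigma> m 3 by auto
    qed
  qed
  then have S: "?S = ?A \<union> ?B \<union> ?C" by blast
  have inj: "i = j" if "\<sigma> \<in> ?S" "\<sigma> i = 0" "\<sigma> j = 0" for \<sigma> i j
    using that by (auto simp: Sh3_nat dest!: permutes_inj dest: injD[of \<sigma> i j])
  have disj: "?A \<inter> ?B = {}" "(?A \<union> ?B) \<inter> ?C = {}"
    using inj[of _ 0 a] inj[of _ 0 "a + b"] inj[of _ a "a + b"] by fastforce+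
  have fin: "finite ?A" "finite ?B" "finite ?C" by (simp_all add: finite_Sh3)
  have "sum f ?S = sum f (?A \<union> ?B \<union> ?C)" using S by simp
  also have "\<dots> = sum f ?A + sum f ?B + sum f ?C"
    using fin disj by (simp add: sum.union_disjoint)
  also have "sum f ?A = (case a of 0 \<Rightarrow> 0 | Suc a' \<Rightarrow> \<Sum>\<sigma>\<in>Sh3 a' b (int c). f (ext_perm 0 \<sigma>))"
    by (cases a) (simp_all del: of_nat_Suc add: Sh3_ext_perm sum.reindex inj_on_subset[OF inj_ext_perm])
  also have "sum f ?B = (case b of 0 \<Rightarrow> 0 | Suc b' \<Rightarrow> \<Sum>\<sigma>\<in>Sh3 a b' (int c). f (ext_perm a \<sigma>))"
    by (cases b) (simp_all del: of_nat_Suc add: Sh3_ext_perm sum.reindex inj_on_subset[OF inj_ext_perm])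
  also have "sum f ?C = (case c of 0 \<Rightarrow> 0 | Suc c' \<Rightarrow> \<Sum>\<sigma>\<in>Sh3 a b (int c'). f (ext_perm (a + b) \<sigma>))"
    by (cases c) (simp_all del: of_nat_Suc add: Sh3_ext_perm sum.reindex inj_on_subset[OF inj_ext_perm])
  finally show ?thesis .
qed

text \<open>One weight for two uses: with \<open>d = 0\<close> it is the signature needed inside the
  brackets (\<open>shuffle_weight_zero\<close>), on the list \<open>[0..<n]\<close> of labels it is
  the sign in the axioms (\<open>shuffle_weight_upt\<close>).\<close>

definition shuffle_weight :: "('a \<Rightarrow> int) \<Rightarrow> 'a list \<Rightarrow> (nat \<Rightarrow> nat) \<Rightarrow> int" where
  "shuffle_weight d us \<sigma> = sign \<sigma> * koszul_sign (length us) (\<lambda>i. d (us ! i)) \<sigma>"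

lemma shuffle_weight_ext_perm:
  assumes "\<sigma> permutes {..<length us}" "m \<le> length us"
  shows "shuffle_weight d (u # us) (ext_perm m \<sigma>) =
    (if swap_parity d u (block us \<sigma> 0 m) then -1 else 1) * shuffle_weight d us \<sigma>"
  unfolding shuffle_weight_def block_def swap_parity_prod[symmetric]
  using assms by (simp add: sign_ext_perm koszul_sign_ext_perm)

text \<open>Each summand of \<open>sum_Sh3_Suc\<close> is an instance of the induction hypothesis
  for a modified \<open>F\<close>, which prepends \<open>u\<close> to one block and absorbs the swap
  sign; hence the generalisation over \<open>F\<close>.\<close>

lemma (in vector_space) sum_Sh3_eq_unshuffle3:
  assumes "length us = a + b + c"
  shows "(\<Sum>\<sigma>\<in>Sh3 a b (int c). scale (of_int (shuffle_weight d us \<sigma>))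
      (F (block us \<sigma> 0 a) (block us \<sigma> a (a + b)) (block us \<sigma> (a + b) (a + b + c)))) =
    unshuffle3 d us (\<lambda>xs ys zs. only_if (length xs = a \<and> length ys = b \<and> length zs = c) (F xs ys zs))"
  using assms
proof (induction us arbitrary: a b c F)
  case Nil
  have "Sh3 0 0 (int 0) = {id}" unfolding Sh3_nat by (auto simp: strict_mono_on_def)
  then show ?case using Nil by (simp add: block_def only_if_def shuffle_weight_def koszul_sign_def)
next
  case (Cons u us)
  have block_append: "block us \<sigma> 0 (a + b) = block us \<sigma> 0 a @ block us \<sigma> a (a + b)" for \<sigma> a b
    unfolding block_def by (simp add: upt_add_eq_append[of 0 a b, simplified])
  have len [simp]: "length (block us \<sigma> i j) = j - i" for \<sigma> i j
    by (simp add: block_def)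
  let ?w = "\<lambda>us \<sigma>. scale (of_int (shuffle_weight d us \<sigma>))"
  let ?U = "\<lambda>F a b c. unshuffle3 d us (\<lambda>xs ys zs. only_if (length xs = a \<and> length ys = b \<and> length zs = c) (F xs ys zs))"
  let ?G = "\<lambda>\<tau>. ?w (u # us) \<tau> (F (block (u # us) \<tau> 0 a) (block (u # us) \<tau> a (a + b)) (block (u # us) \<tau> (a + b) (a + b + c)))"
  have w: "?w (u # us) (ext_perm m \<sigma>) x = ?w us \<sigma> (neg_if (swap_parity d u (block us \<sigma> 0 m)) x)"
    if "\<sigma> \<in> Sh3 a' b' (int c')" "length us = a' + b' + c'" "m \<le> length us" for \<sigma> m x a' b' c'
    using that by (auto simp: Sh3_nat shuffle_weight_ext_perm neg_if_def)
  have "(\<Sum>\<tau>\<in>Sh3 a b (int c). ?G \<tau>) =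
     (case a of 0 \<Rightarrow> 0 | Suc a' \<Rightarrow> \<Sum>\<sigma>\<in>Sh3 a' b (int c). ?G (ext_perm 0 \<sigma>))
    + (case b of 0 \<Rightarrow> 0 | Suc b' \<Rightarrow> \<Sum>\<sigma>\<in>Sh3 a b' (int c). ?G (ext_perm a \<sigma>))
    + (case c of 0 \<Rightarrow> 0 | Suc c' \<Rightarrow> \<Sum>\<sigma>\<in>Sh3 a b (int c'). ?G (ext_perm (a + b) \<sigma>))"
    by (rule sum_Sh3_Suc[of _ _ _ "length us"]) (use Cons.prems in simp)
  also have "(case a of 0 \<Rightarrow> 0 | Suc a' \<Rightarrow> \<Sum>\<sigma>\<in>Sh3 a' b (int c). ?G (ext_perm 0 \<sigma>)) =
      unshuffle3 d us (\<lambda>xs ys zs. only_if (length (u # xs) = a \<and> length ys = b \<and> length zs = c) (F (u # xs) ys zs))"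
  \<comment> \<open>For \<open>a = 0\<close> no shuffle puts \<open>u\<close> into the first block,
    and the length guard on the other side is never met, so both are 0.\<close>
  proof (cases a)
    case (Suc a')
    have "(\<Sum>\<sigma>\<in>Sh3 a' b (int c). ?G (ext_perm 0 \<sigma>)) =
        (\<Sum>\<sigma>\<in>Sh3 a' b (int c). ?w us \<sigma> (F (u # block us \<sigma> 0 a') (block us \<sigma> a' (a' + b)) (block us \<sigma> (a' + b) (a' + b + c))))"
      using Cons.prems Suc
      by (intro sum.cong refl) (simp add: w block_ext_perm block_ext_perm(2)[of _ _ 0, simplified] swap_parity_def block_def[of _ _ 0 0])
    also have "\<dots> = ?U (\<lambda>xs. F (u # xs)) a' b c"
      using Cons.prems Suc by (intro Cons.IH) simp
    finally show ?thesis using Suc by simp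
  qed (simp add: only_if_def)
  also have "(case b of 0 \<Rightarrow> 0 | Suc b' \<Rightarrow> \<Sum>\<sigma>\<in>Sh3 a b' (int c). ?G (ext_perm a \<sigma>)) =
      unshuffle3 d us (\<lambda>xs ys zs. neg_if (swap_parity d u xs) (only_if (length xs = a \<and> length (u # ys) = b \<and> length zs = c) (F xs (u # ys) zs)))"
  proof (cases b)
    case (Suc b')
    have "(\<Sum>\<sigma>\<in>Sh3 a b' (int c). ?G (ext_perm a \<sigma>)) =
        (\<Sum>\<sigma>\<in>Sh3 a b' (int c). ?w us \<sigma> (neg_if (swap_parity d u (block us \<sigma> 0 a)) (F (block us \<sigma> 0 a) (u # block us \<sigma> a (a + b')) (block us \<sigma> (a + b') (a + b' + c)))))"
      using Cons.prems Suc by (intro sum.cong refl) (simp add: w block_ext_perm)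
    also have "\<dots> = ?U (\<lambda>xs ys zs. neg_if (swap_parity d u xs) (F xs (u # ys) zs)) a b' c"
      using Cons.prems Suc by (intro Cons.IH) simp
    finally show ?thesis using Suc by (simp add: neg_if_only_if)
  qed (simp add: only_if_def)
  also have "(case c of 0 \<Rightarrow> 0 | Suc c' \<Rightarrow> \<Sum>\<sigma>\<in>Sh3 a b (int c'). ?G (ext_perm (a + b) \<sigma>)) =
      unshuffle3 d us (\<lambda>xs ys zs. neg_if (swap_parity d u (xs @ ys)) (only_if (length xs = a \<and> length ys = b \<and> length (u # zs) = c) (F xs ys (u # zs))))"
  proof (cases c)
    case (Suc c')
    have "(\<Sum>\<sigma>\<in>Sh3 a b (int c'). ?G (ext_perm (a + b) \<sigma>)) =
        (\<Sum>\<sigma>\<in>Sh3 a b (int c'). ?w us \<sigma> (neg_if (swap_parity d u (block us \<sigma> 0 a @ block us \<sigma> a (a + b))) (F (block us \<sigma> 0 a) (block us \<sigma> a (a + b)) (u # block us \<sigma> (a + b) (a + b + c')))))"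
      using Cons.prems Suc by (intro sum.cong refl) (simp add: w block_ext_perm block_append)
    also have "\<dots> = ?U (\<lambda>xs ys zs. neg_if (swap_parity d u (xs @ ys)) (F xs ys (u # zs))) a b c'"
      using Cons.prems Suc by (intro Cons.IH) simp
    finally show ?thesis using Suc by (simp add: neg_if_only_if)
  qed (simp add: only_if_def)
  finally show ?case by simp
qed

section \<open>The graded Lie product and insertion of alternating maps\<close>

primrec unshuffle2 :: "'a list \<Rightarrow> ('a list \<Rightarrow> 'a list \<Rightarrow> 'b::ab_group_add) \<Rightarrow> 'b" where
  "unshuffle2 [] F = F [] []"
| "unshuffle2 (u # us) F =
     unshuffle2 us (\<lambda>xs ys. F (u # xs) ys)
     + unshuffle2 us (\<lambda>xs ys. neg_if (odd (length xs)) (F xs (u # ys)))"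

lemma neg_if_add: "neg_if s (x + y) = neg_if s x + neg_if s y"
  by (simp add: neg_if_def)

lemma neg_if_additive: "Modules.additive h \<Longrightarrow> h (neg_if s x) = neg_if s (h x)"
  by (simp add: neg_if_def additive.minus)

lemma unshuffle2_cong:
  "(\<And>xs ys. length xs + length ys = length us \<Longrightarrow> F xs ys = G xs ys) \<Longrightarrow> unshuffle2 us F = unshuffle2 us G"
proof (induction us arbitrary: F G)
  case (Cons u us)
  show ?case
    unfolding unshuffle2.simps
    by (intro arg_cong2[of _ _ _ _ "(+)"] Cons.IH) (simp_all add: Cons.prems)
qed simp

lemma unshuffle2_add: "unshuffle2 us (\<lambda>xs ys. F xs ys + G xs ys) = unshuffle2 us F + unshuffle2 us G"
  by (induction us arbitrary: F G) (simp_all add: neg_if_add)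

lemma unshuffle2_hom:
  "Modules.additive h \<Longrightarrow> h (unshuffle2 us F) = unshuffle2 us (\<lambda>xs ys. h (F xs ys))"
  by (induction us arbitrary: F) (simp_all add: additive.add neg_if_additive)

lemma additive_neg_if: "Modules.additive (neg_if s)"
  by unfold_locales (rule neg_if_add)

lemma unshuffle2_neg_if: "neg_if s (unshuffle2 us F) = unshuffle2 us (\<lambda>xs ys. neg_if s (F xs ys))"
  by (rule unshuffle2_hom[OF additive_neg_if])

lemma unshuffle2_zero [simp]: "unshuffle2 us (\<lambda>xs ys. 0) = 0"
  by (induction us) auto

lemma unshuffle2_right_Nil: "unshuffle2 us (\<lambda>xs ys. only_if (ys = []) (F xs)) = F us"
  by (induction us arbitrary: F) (simp_all add: only_if_def)

text \<open>Splitting off the last block first and then dividing the rest is what makes a sum over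
  three blocks an insertion of a product. A vector entering the last block passes all of
  \<open>ws\<close>, that is, both other blocks.\<close>

lemma unshuffle3_eq_unshuffle2:
  "unshuffle3 (\<lambda>_. 0) us F = unshuffle2 us (\<lambda>ws zs. unshuffle2 ws (\<lambda>xs ys. F xs ys zs))"
proof (induction us arbitrary: F)
  case (Cons u us)
  have "unshuffle2 us (\<lambda>ws zs. neg_if (odd (length ws)) (unshuffle2 ws (\<lambda>xs ys. F xs ys (u # zs)))) =
    unshuffle2 us (\<lambda>ws zs. unshuffle2 ws (\<lambda>xs ys. neg_if (odd (length (xs @ ys))) (F xs ys (u # zs))))"
    unfolding unshuffle2_neg_if by (intro unshuffle2_cong) auto
  then show ?case
    by (simp add: Cons.IH unshuffle2_add swap_parity_def)
qed simp

section \<open>Contraction, parity and the grading involution\<close>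

definition contr :: "'a \<Rightarrow> ('a list \<Rightarrow> 'b) \<Rightarrow> 'a list \<Rightarrow> 'b" where
  "contr u f = (\<lambda>us. f (u # us))"

text \<open>Only the parity of the number of arguments is fixed, not the number itself; the zero map
  has both parities.\<close>

definition parity :: "bool \<Rightarrow> ('a list \<Rightarrow> 'b::zero) \<Rightarrow> bool" where
  "parity s f \<longleftrightarrow> (\<forall>us. odd (length us) \<noteq> s \<longrightarrow> f us = 0)"

text \<open>The grading involution: it carries the sign of the Leibniz rules for maps that need not
  be homogeneous.\<close>

definition bar :: "('a list \<Rightarrow> 'b::ab_group_add) \<Rightarrow> 'a list \<Rightarrow> 'b" where
  "bar f = (\<lambda>us. neg_if (odd (length us)) (f us))"

lemma bar_parity: "parity s f \<Longrightarrow> bar f = neg_if s f"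
  by (auto simp: parity_def bar_def neg_if_def fun_eq_iff)

lemma parity_contr: "parity s f \<Longrightarrow> parity (\<not> s) (contr u f)"
  by (auto simp: parity_def contr_def)

lemma neg_if_fun: "neg_if s f us = neg_if s (f us)"
  by (simp add: neg_if_def)

lemma contr_apply: "f (u # us) = contr u f us"
  by (simp add: contr_def)

lemma contr_additive: "Modules.additive (contr u)"
  by unfold_locales (simp add: contr_def fun_eq_iff)

lemmas contr_hom = additive.add[OF contr_additive] additive.zero[OF contr_additive]
  additive.minus[OF contr_additive] additive.diff[OF contr_additive] neg_if_additive[OF contr_additive]

context lie_algebra begin

text \<open>The number of arguments is left open because contraction lowers it. Equal arguments are
  only required to be adjacent; \<open>alternating_repeated\<close> gives the general case.\<close>

definition alternating :: "('g list \<Rightarrow> 'g) \<Rightarrow> bool" where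
  "alternating f \<longleftrightarrow>
     (\<forall>xs x y ys. f (xs @ (x + y) # ys) = f (xs @ x # ys) + f (xs @ y # ys)) \<and>
     (\<forall>xs c x ys. f (xs @ scale c x # ys) = scale c (f (xs @ x # ys))) \<and>
     (\<forall>xs x ys. f (xs @ x # x # ys) = 0)"

lemma alternatingD:
  assumes "alternating f"
  shows "f (xs @ (x + y) # ys) = f (xs @ x # ys) + f (xs @ y # ys)"
    and "f (xs @ scale c x # ys) = scale c (f (xs @ x # ys))"
    and "f (xs @ x # x # ys) = 0"
  using assms by (auto simp: alternating_def)

lemma alternating_head:
  assumes "alternating f"
  shows "f ((x + y) # ys) = f (x # ys) + f (y # ys)"
    and "f (scale c x # ys) = scale c (f (x # ys))"
    and "f (x # x # ys) = 0" and "f (0 # ys) = 0" and "f (- x # ys) = - f (x # ys)"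
proof -
  show *: "f ((x + y) # ys) = f (x # ys) + f (y # ys)" for x y
    using alternatingD(1)[OF assms, of "[]"] by simp
  show "f (scale c x # ys) = scale c (f (x # ys))" "f (x # x # ys) = 0"
    using alternatingD(2,3)[OF assms, of "[]"] by simp_all
  show 0: "f (0 # ys) = 0" using *[of 0 0] by simp
  show "f (- x # ys) = - f (x # ys)" using *[of x "- x"] 0 by (simp add: minus_unique)
qed

lemma alternating_additive: "alternating f \<Longrightarrow> Modules.additive (\<lambda>x. f (x # ys))"
  by unfold_locales (rule alternating_head)

lemma alternating_contr: "alternating f \<Longrightarrow> alternating (contr u f)"
  unfolding alternating_def contr_def by (metis append_Cons)

lemma alternating_contr_simps:
  assumes "alternating f"
  shows "contr (x + y) f = contr x f + contr y f"
    and "contr (scale c x) f = cochain_scale scale c (contr x f)"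
    and "contr x (contr x f) = 0"
  using alternating_head[OF assms] by (auto simp: contr_def cochain_scale_def fun_eq_iff)

lemma alternating_swap:
  assumes "alternating f"
  shows "f (xs @ x # y # ys) = - f (xs @ y # x # ys)"
proof -
  have "0 = f (xs @ (x + y) # (x + y) # ys)"
    by (simp add: alternatingD[OF assms])
  also have "\<dots> = f (xs @ x # (x + y) # ys) + f (xs @ y # (x + y) # ys)"
    by (rule alternatingD[OF assms])
  also have "\<dots> = f (xs @ x # y # ys) + f (xs @ y # x # ys)"
    using alternatingD(1)[OF assms, of "xs @ [x]" x y ys] alternatingD(1)[OF assms, of "xs @ [y]" x y ys]
    by (simp add: alternatingD[OF assms])
  finally show ?thesis by (simp add: eq_neg_iff_add_eq_0)
qed

lemma alternating_add: "alternating f \<Longrightarrow> alternating g \<Longrightarrow> alternating (f + g)"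
  by (simp add: alternating_def scale_right_distrib)

lemma alternating_neg_if: "alternating f \<Longrightarrow> alternating (neg_if s f)"
  by (auto simp: alternating_def neg_if_def)

lemma alternating_scale: "alternating f \<Longrightarrow> alternating (cochain_scale scale c f)"
  by (simp add: alternating_def cochain_scale_def scale_right_distrib mult.commute)

lemma alternating_zero: "alternating 0"
  by (simp add: alternating_def)

lemma alternating_bar: "alternating f \<Longrightarrow> alternating (bar f)"
  by (simp add: alternating_def bar_def neg_if_def)

section \<open>Product and insertion\<close>

definition conv :: "('g list \<Rightarrow> 'g) \<Rightarrow> ('g list \<Rightarrow> 'g) \<Rightarrow> 'g list \<Rightarrow> 'g" where
  "conv f g us = unshuffle2 us (\<lambda>xs ys. bracket (f xs) (g ys))"

definition ins :: "('g list \<Rightarrow> 'g) \<Rightarrow> ('g list \<Rightarrow> 'g) \<Rightarrow> 'g list \<Rightarrow> 'g" where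
  "ins X f us = unshuffle2 us (\<lambda>xs ys. f (X xs # ys))"

lemma bracket_additive: "Modules.additive (\<lambda>x. bracket x y)" "Modules.additive (bracket x)"
  by unfold_locales (simp_all add: bracket_add_left bracket_add_right)

lemmas bracket_simps = additive.zero[OF bracket_additive(1)] additive.zero[OF bracket_additive(2)]
  additive.minus[OF bracket_additive(1)] additive.minus[OF bracket_additive(2)]
  neg_if_additive[OF bracket_additive(1)] neg_if_additive[OF bracket_additive(2)]

lemma bracket_anticommute: "bracket x y = - bracket y x"
proof -
  have "0 = bracket (x + y) (x + y)" by (simp only: bracket_self)
  also have "\<dots> = bracket x y + bracket y x"
    by (simp only: bracket_add_left bracket_add_right) (simp add: bracket_self)
  finally show ?thesis by (metis eq_neg_iff_add_eq_0)
qed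

lemma bracket_leibniz: "bracket x (bracket y z) = bracket (bracket x y) z + bracket y (bracket x z)"
proof -
  have "bracket y (bracket z x) = - bracket y (bracket x z)"
    by (subst bracket_anticommute[of z x]) (simp add: bracket_simps)
  moreover have "bracket z (bracket x y) = - bracket (bracket x y) z"
    by (rule bracket_anticommute)
  ultimately have "bracket x (bracket y z) - (bracket (bracket x y) z + bracket y (bracket x z)) =
      bracket x (bracket y z) + bracket y (bracket z x) + bracket z (bracket x y)"
    by simp
  then show ?thesis by (simp add: jacobi)
qed

lemma conv_Nil: "conv f g [] = bracket (f []) (g [])"
  by (simp add: conv_def)

lemma conv_Cons: "conv f g (u # us) = conv (contr u f) g us + conv (bar f) (contr u g) us"
  by (simp add: conv_def contr_def bar_def bracket_simps)

lemma ins_Nil: "ins X f [] = f [X []]"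
  by (simp add: ins_def)

text \<open>In \<open>f\<close> the inserted value is exchanged with \<open>u\<close>, which costs
  the minus sign; the shuffle sign is moved into the inserted value and becomes
  \<open>bar X\<close>.\<close>

lemma ins_Cons:
  assumes "alternating f"
  shows "ins X f (u # us) = ins (contr u X) f us - ins (bar X) (contr u f) us"
proof -
  have "neg_if s (f (x # u # ys)) = - f (u # neg_if s x # ys)" for s x ys
    using alternating_swap[OF assms, of "[]" x u ys]
      alternating_head(5)[OF alternating_contr[OF assms], of u x ys, unfolded contr_def]
    by (simp add: neg_if_def)
  then have "ins X f (u # us) = ins (contr u X) f us + unshuffle2 us (\<lambda>xs ys. - (contr u f (bar X xs # ys)))"
    by (simp add: ins_def contr_def bar_def)
  also have "unshuffle2 us (\<lambda>xs ys. - (contr u f (bar X xs # ys))) = - ins (bar X) (contr u f) us"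
    unfolding ins_def by (rule unshuffle2_neg_if[of True us, unfolded neg_if_simps, symmetric])
  finally show ?thesis by simp
qed

lemma conv_add: "conv (f + f') g = conv f g + conv f' g" "conv f (g + g') = conv f g + conv f g'"
  by (auto simp: conv_def fun_eq_iff bracket_add_left bracket_add_right unshuffle2_add)

lemma conv_additive: "Modules.additive (\<lambda>f. conv f g)" "Modules.additive (conv f)"
  by unfold_locales (simp_all add: conv_add)

lemma ins_add: "ins X (f + g) = ins X f + ins X g"
  by (auto simp: ins_def fun_eq_iff unshuffle2_add)

lemma ins_additive: "Modules.additive (ins X)"
  by unfold_locales (simp add: ins_add)

lemma ins_add_left: "alternating f \<Longrightarrow> ins (X + Y) f = ins X f + ins Y f"
  by (auto simp: ins_def fun_eq_iff unshuffle2_add alternating_head)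

lemma ins_additive_left: "alternating f \<Longrightarrow> Modules.additive (\<lambda>X. ins X f)"
  by unfold_locales (simp add: ins_add_left)

lemmas conv_hom = conv_add
  additive.zero[OF conv_additive(1)] additive.zero[OF conv_additive(2)]
  additive.minus[OF conv_additive(1)] additive.minus[OF conv_additive(2)]
  additive.diff[OF conv_additive(1)] additive.diff[OF conv_additive(2)]
  neg_if_additive[OF conv_additive(1)] neg_if_additive[OF conv_additive(2)]

lemmas ins_hom = ins_add
  additive.zero[OF ins_additive] additive.minus[OF ins_additive]
  additive.diff[OF ins_additive] neg_if_additive[OF ins_additive]

lemmas ins_hom_left = ins_add_left
  additive.zero[OF ins_additive_left] additive.minus[OF ins_additive_left]
  additive.diff[OF ins_additive_left] neg_if_additive[OF ins_additive_left]

lemma additive_scale: "Modules.additive (scale c)"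
  by unfold_locales (rule scale_right_distrib)

lemma conv_scale:
  "conv (cochain_scale scale c f) g = cochain_scale scale c (conv f g)"
  "conv f (cochain_scale scale c g) = cochain_scale scale c (conv f g)"
  by (auto simp: conv_def cochain_scale_def fun_eq_iff bracket_scale_left bracket_scale_right
      unshuffle2_hom[OF additive_scale])

lemma ins_scale: "ins X (cochain_scale scale c f) = cochain_scale scale c (ins X f)"
  by (auto simp: ins_def cochain_scale_def fun_eq_iff unshuffle2_hom[OF additive_scale])

lemma ins_scale_left: "alternating f \<Longrightarrow> ins (cochain_scale scale c X) f = cochain_scale scale c (ins X f)"
  by (auto simp: ins_def cochain_scale_def fun_eq_iff unshuffle2_hom[OF additive_scale] alternating_head)

lemma contr_conv: "contr u (conv f g) = conv (contr u f) g + conv (bar f) (contr u g)"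
  by (auto simp: fun_eq_iff conv_Cons contr_def[of _ "conv f g"])

lemma contr_ins: "alternating f \<Longrightarrow> contr u (ins X f) = ins (contr u X) f - ins (bar X) (contr u f)"
  by (auto simp: fun_eq_iff ins_Cons contr_def[of _ "ins X f"])

lemma contr_bar: "contr u (bar f) = - bar (contr u f)"
  by (auto simp: fun_eq_iff contr_def bar_def neg_if_def)

lemma bar_bar: "bar (bar f) = f"
  by (auto simp: fun_eq_iff bar_def neg_if_def)

text \<open>A slot is reached by contracting with the arguments before it. The contraction of a
  product is a sum of two products, so the class \<open>A\<close> is only required to be closed
  under contraction up to sums.\<close>

lemma alternatingI_contr:
  assumes "\<And>f x y us. A f \<Longrightarrow> contr (x + y) f us = contr x f us + contr y f us"
    and "\<And>f c x us. A f \<Longrightarrow> contr (scale c x) f us = scale c (contr x f us)"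
    and "\<And>f x us. A f \<Longrightarrow> contr x (contr x f) us = 0"
    and step: "\<And>f u. A f \<Longrightarrow> \<exists>g h. A g \<and> A h \<and> contr u f = g + h"
    and "A f"
  shows "alternating f"
proof -
  have "f (xs @ (x + y) # ys) = f (xs @ x # ys) + f (xs @ y # ys) \<and>
      f (xs @ scale c x # ys) = scale c (f (xs @ x # ys)) \<and> f (xs @ x # x # ys) = 0"
    for xs x y c ys
    using \<open>A f\<close>
  proof (induction xs arbitrary: f)
    case Nil
    with assms(1-3) show ?case by (simp add: contr_def)
  next
    case (Cons u xs)
    obtain g h where gh: "A g" "A h" "contr u f = g + h" using step[OF Cons.prems] by blast
    have "f (u # us) = g us + h us" for us
      using fun_cong[OF gh(3), of us] by (simp add: contr_def)
    then show ?case using Cons.IH[OF gh(1)] Cons.IH[OF gh(2)]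
      by (simp add: scale_right_distrib)
  qed
  then show ?thesis by (simp add: alternating_def)
qed

lemma alternating_conv:
  assumes "alternating f" "alternating g"
  shows "alternating (conv f g)"
proof -
  define A where "A h \<longleftrightarrow> (\<exists>f g. h = conv f g \<and> alternating f \<and> alternating g)" for h
  have intro: "A (conv f g)" if "alternating f" "alternating g" for f g
    using that by (auto simp: A_def)
  show ?thesis
  proof (rule alternatingI_contr[of A])
    show "A (conv f g)" using assms by (rule intro)
    fix h assume "A h"
    then obtain f g where h: "h = conv f g" and fg: "alternating f" "alternating g"
      by (auto simp: A_def)
    note bar = fg[THEN alternating_bar]
    note simps = h contr_conv conv_hom conv_scale alternating_contr_simps[OF fg(1)]
      alternating_contr_simps[OF fg(2)] bar_bar contr_bar
    show "contr (x + y) h us = contr x h us + contr y h us" for x y us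
      by (simp add: simps algebra_simps)
    show "contr (scale c x) h us = scale c (contr x h us)" for c x us
      by (simp add: simps) (simp add: cochain_scale_def scale_right_distrib)
    show "contr x (contr x h) us = 0" for x us
    proof -
      have "contr x (contr x h) = contr x (conv (contr x f) g) + contr x (conv (bar f) (contr x g))"
        by (simp only: h contr_conv contr_hom)
      \<comment> \<open>Terms with both contractions on one factor vanish; the two mixed terms
        cancel because \<open>contr x\<close> anticommutes with \<open>bar\<close>.\<close>
      also have "\<dots> = 0" by (simp add: simps)
      finally show ?thesis by simp
    qed
    show "\<exists>g h'. A g \<and> A h' \<and> contr u h = g + h'" for u
      unfolding h contr_conv using fg bar by (blast intro: intro alternating_contr)
  qed
qed

lemma alternating_ins:
  assumes "alternating X" "alternating f"
  shows "alternating (ins X f)"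
proof -
  define A where "A h \<longleftrightarrow> (\<exists>f g. h = ins f g \<and> alternating f \<and> alternating g)" for h
  have intro: "A (ins f g)" if "alternating f" "alternating g" for f g
    using that by (auto simp: A_def)
  show ?thesis
  proof (rule alternatingI_contr[of A])
    show "A (ins X f)" using assms by (rule intro)
    fix h assume "A h"
    then obtain f g where h: "h = ins f g" and fg: "alternating f" "alternating g"
      by (auto simp: A_def)
    note bar = fg[THEN alternating_bar]
    note simps = h contr_ins[OF fg(2)] contr_ins[OF alternating_contr[OF fg(2)]] ins_hom
      ins_hom_left[OF fg(2)] ins_hom_left[OF alternating_contr[OF fg(2)]] ins_scale
      ins_scale_left[OF fg(2)] alternating_contr_simps[OF fg(1)]
      alternating_contr_simps[OF fg(2)] bar_bar contr_bar
    show "contr (x + y) h us = contr x h us + contr y h us" for x y us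
      by (simp add: simps algebra_simps)
    show "contr (scale c x) h us = scale c (contr x h us)" for c x us
      by (simp add: simps) (simp add: cochain_scale_def scale_right_diff_distrib)
    show "contr x (contr x h) us = 0" for x us
    proof -
      have "contr x (contr x h) = contr x (ins (contr x f) g) - contr x (ins (bar f) (contr x g))"
        by (simp only: h contr_ins[OF fg(2)] contr_hom)
      also have "\<dots> = 0" by (simp add: simps)
      finally show ?thesis by simp
    qed
    show "\<exists>g h'. A g \<and> A h' \<and> contr u h = g + h'" for u
    proof (intro exI conjI)
      \<comment> \<open>The minus sign is moved into the contracted map, since the criterion allows
        sums only.\<close>
      show "contr u h = ins (contr u f) g + ins (bar f) (neg_if True (contr u g))"
        by (simp add: simps)
    qed (auto intro!: intro fg bar alternating_contr alternating_neg_if simp del: neg_if_simps)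
  qed
qed

end

section \<open>Graded Lie, derivation and pre-Lie laws\<close>

context lie_algebra begin

definition unit_cochain :: "'g list \<Rightarrow> 'g" where
  "unit_cochain = linear_cochain (\<lambda>x. x)"

lemma unit_cochain_Cons: "unit_cochain (u # us) = only_if (us = []) u"
  by (auto simp: unit_cochain_def linear_cochain_def only_if_def)

lemma alternating_unit: "alternating unit_cochain"
  by (auto simp: alternating_def unit_cochain_def linear_cochain_def append_eq_Cons_conv)

lemma parity_unit: "parity True unit_cochain"
  by (auto simp: parity_def unit_cochain_def linear_cochain_def)

lemma ins_unit: "ins X unit_cochain = X"
  by (simp add: ins_def unit_cochain_Cons unshuffle2_right_Nil fun_eq_iff)

lemma contr_conv_parity:
  "parity s f \<Longrightarrow> contr u (conv f g) = conv (contr u f) g + neg_if s (conv f (contr u g))"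
  by (simp add: contr_conv bar_parity conv_hom)

text \<open>As an operator, \<open>ins X\<close> has degree one less than \<open>X\<close>, so the
  odd operator \<open>contr u\<close> passes it with sign \<open>\<not> x\<close>.\<close>

lemma contr_ins_parity:
  "parity x X \<Longrightarrow> alternating f \<Longrightarrow>
    contr u (ins X f) = ins (contr u X) f + neg_if (\<not> x) (ins X (contr u f))"
  by (cases x) (simp_all add: contr_ins bar_parity alternating_contr ins_hom_left)

lemma parity_Nil: "parity True f \<Longrightarrow> f [] = 0"
  by (simp add: parity_def)

lemma parity_conv: "parity s f \<Longrightarrow> parity t g \<Longrightarrow> parity (s \<noteq> t) (conv f g)"
  unfolding parity_def
proof (intro allI impI)
  fix us :: "'g list"
  assume f: "\<forall>us. odd (length us) \<noteq> s \<longrightarrow> f us = 0" and g: "\<forall>us. odd (length us) \<noteq> t \<longrightarrow> g us = 0"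
    and us: "odd (length us) \<noteq> (s \<noteq> t)"
  have "conv f g us = unshuffle2 us (\<lambda>xs ys. 0)"
    unfolding conv_def
  proof (rule unshuffle2_cong)
    fix xs ys :: "'g list" assume "length xs + length ys = length us"
    with us have "odd (length xs) \<noteq> s \<or> odd (length ys) \<noteq> t" by (metis even_add)
    with f g have "f xs = 0 \<or> g ys = 0" by blast
    then show "bracket (f xs) (g ys) = 0" by (auto simp: bracket_simps)
  qed
  then show "conv f g us = 0" by simp
qed

text \<open>\<open>x = s\<close> encodes the parity of the sum of the degrees minus one: insertion
  uses up one argument slot.\<close>

lemma parity_ins:
  assumes "parity x X" "parity s f" "alternating f"
  shows "parity (x = s) (ins X f)"
  unfolding parity_def
proof (intro allI impI)
  fix us :: "'g list"
  assume us: "odd (length us) \<noteq> (x = s)"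
  have "ins X f us = unshuffle2 us (\<lambda>xs ys. 0)"
    unfolding ins_def
  proof (rule unshuffle2_cong)
    fix xs ys :: "'g list" assume "length xs + length ys = length us"
    with us have "odd (length xs) \<noteq> x \<or> odd (Suc (length ys)) \<noteq> s" by (metis even_Suc even_add)
    then show "f (X xs # ys) = 0"
      using assms by (auto simp: parity_def alternating_head)
  qed
  then show "ins X f us = 0" by simp
qed

text \<open>In the induction step contraction distributes over the factors, and each term is the
  hypothesis for one contracted factor, with its parity flipped. On the empty list odd maps vanish,
  and for even ones the law is that of the bracket. The next three laws follow by the same kind of
  induction.\<close>

lemma conv_commute:
  assumes "parity s f" "parity t g"
  shows "conv f g = neg_if (\<not> (s \<and> t)) (conv g f)"
proof
  fix us show "conv f g us = neg_if (\<not> (s \<and> t)) (conv g f) us"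
    using assms
  proof (induction us arbitrary: f g s t)
    case Nil
    then show ?case
      using bracket_anticommute[of "f []" "g []"]
      by (cases s; cases t) (auto simp: conv_Nil neg_if_fun parity_Nil bracket_simps)
  next
    case (Cons u us)
    note p = Cons.prems
    note IH = Cons.IH[OF p(1) parity_contr[OF p(2)], of u] Cons.IH[OF parity_contr[OF p(1)] p(2), of u]
    show ?case
      using IH unfolding contr_apply[of _ u us] contr_hom contr_conv_parity[OF p(1)] contr_conv_parity[OF p(2)]
      by (cases s; cases t) (simp_all add: neg_if_fun algebra_simps)
  qed
qed

lemma conv_leibniz:
  assumes "parity s f" "parity t g" "parity r h"
  shows "conv f (conv g h) = conv (conv f g) h + neg_if (s \<and> t) (conv g (conv f h))"
proof
  fix us show "conv f (conv g h) us = (conv (conv f g) h + neg_if (s \<and> t) (conv g (conv f h))) us"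
    using assms
  proof (induction us arbitrary: f g h s t r)
    case Nil
    then show ?case
      using bracket_leibniz[of "f []" "g []" "h []"]
      by (cases s; cases t) (auto simp: conv_Nil neg_if_fun parity_Nil bracket_simps)
  next
    case (Cons u us)
    note p = Cons.prems
    note q = p[THEN parity_contr, of u]
    note IH = Cons.IH[OF q(1) p(2,3)] Cons.IH[OF p(1) q(2) p(3)] Cons.IH[OF p(1,2) q(3)]
    note c = contr_conv_parity[OF p(1)] contr_conv_parity[OF p(2)] contr_conv_parity[OF p(3)]
      contr_conv_parity[OF parity_conv[OF p(1,2)]]
    show ?case
      using IH unfolding contr_apply[of _ u us] contr_hom c
      by (cases s; cases t) (simp_all add: conv_hom neg_if_fun algebra_simps)
  qed
qed

text \<open>The sign is that of a derivation of parity \<open>\<not> x\<close> passing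
  \<open>f\<close>.\<close>

lemma ins_conv:
  assumes "parity x X" "parity s f" "alternating f" "alternating g"
  shows "ins X (conv f g) = conv (ins X f) g + neg_if (\<not> x \<and> s) (conv f (ins X g))"
proof
  fix us show "ins X (conv f g) us = (conv (ins X f) g + neg_if (\<not> x \<and> s) (conv f (ins X g))) us"
    using assms
  proof (induction us arbitrary: X f g x s)
    case Nil
    then show ?case
      by (cases x; cases s)
        (auto simp: conv_Nil ins_Nil conv_Cons bar_def contr_def neg_if_fun parity_Nil bracket_simps alternating_head)
  next
    case (Cons u us)
    note p = Cons.prems
    note q = p(1)[THEN parity_contr, of u] p(2)[THEN parity_contr, of u]
      p(3)[THEN alternating_contr, of u] p(4)[THEN alternating_contr, of u]
    note IH = Cons.IH[OF q(1) p(2-4)] Cons.IH[OF p(1) q(2,3) p(4)] Cons.IH[OF p(1-3) q(4)]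
    note c = contr_conv_parity[OF p(2)] contr_ins_parity[OF p(1,3)] contr_ins_parity[OF p(1,4)]
      contr_ins_parity[OF p(1) alternating_conv[OF p(3,4)]]
      contr_conv_parity[OF parity_ins[OF p(1-3)]]
    show ?case
      using IH unfolding contr_apply[of _ u us] contr_hom c
      by (cases x; cases s) (simp_all add: conv_hom ins_hom neg_if_fun algebra_simps)
  qed
qed

text \<open>In \<open>ins X (ins Y f)\<close> the map \<open>X\<close> goes either into
  \<open>Y\<close> or into another argument of \<open>f\<close>. The second part is graded symmetric
  in \<open>X\<close> and \<open>Y\<close>, with parities \<open>\<not> x\<close> and
  \<open>\<not> y\<close>, and cancels in the graded commutator.\<close>

lemma ins_pre_lie:
  assumes "parity x X" "parity y Y" "alternating X" "alternating Y" "alternating f"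
  shows "ins X (ins Y f) =
    neg_if (\<not> x \<and> \<not> y) (ins Y (ins X f)) + ins (ins X Y) f + neg_if (x \<or> y) (ins (ins Y X) f)"
proof
  fix us
  show "ins X (ins Y f) us =
    (neg_if (\<not> x \<and> \<not> y) (ins Y (ins X f)) + ins (ins X Y) f + neg_if (x \<or> y) (ins (ins Y X) f)) us"
    using assms
  proof (induction us arbitrary: X Y f x y)
    case Nil
    then show ?case
      using alternating_swap[of f "[]" "X []" "Y []" "[]"]
      by (cases x; cases y)
        (auto simp: ins_Nil ins_Cons bar_def contr_def neg_if_fun parity_Nil alternating_head)
  next
    case (Cons u us)
    note p = Cons.prems
    note q = p(1)[THEN parity_contr, of u] p(2)[THEN parity_contr, of u]
      p(3)[THEN alternating_contr, of u] p(4)[THEN alternating_contr, of u] p(5)[THEN alternating_contr, of u]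
    note IH = Cons.IH[OF q(1) p(2) q(3) p(4,5)] Cons.IH[OF p(1) q(2) p(3) q(4) p(5)] Cons.IH[OF p(1-4) q(5)]
    note a = alternating_ins[OF p(3) p(4)] alternating_ins[OF p(4) p(3)]
      alternating_ins[OF p(3) p(5)] alternating_ins[OF p(4) p(5)]
    note c = contr_ins_parity[OF p(1,4)] contr_ins_parity[OF p(1,5)] contr_ins_parity[OF p(2,3)]
      contr_ins_parity[OF p(2,5)] contr_ins_parity[OF p(1) a(4)] contr_ins_parity[OF p(2) a(3)]
      contr_ins_parity[OF parity_ins[OF p(1,2,4)] p(5)] contr_ins_parity[OF parity_ins[OF p(2,1,3)] p(5)]
    show ?case
      unfolding contr_apply[of _ u us] contr_hom c
      by (cases x; cases y) (simp_all add: ins_hom ins_hom_left[OF p(5)]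
          ins_hom_left[OF p(5)[THEN alternating_contr]] neg_if_fun IH)
  qed
qed

end

section \<open>The homotopy Jacobi identities\<close>

context lie_algebra begin

definition homog :: "bool \<Rightarrow> ('g list \<Rightarrow> 'g) \<Rightarrow> bool" where
  "homog s f \<longleftrightarrow> parity s f \<and> alternating f"

lemma homog_conv: "homog s f \<Longrightarrow> homog t g \<Longrightarrow> homog (s \<noteq> t) (conv f g)"
  unfolding homog_def using parity_conv alternating_conv by blast

lemma homog_ins: "homog x X \<Longrightarrow> homog s f \<Longrightarrow> homog (x = s) (ins X f)"
  unfolding homog_def using parity_ins alternating_ins by blast

lemma homog_unit: "homog True unit_cochain"
  by (simp add: homog_def parity_unit alternating_unit)

lemma homog_conv_unit: "homog s f \<Longrightarrow> homog (\<not> s) (conv f unit_cochain)"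
  using homog_conv[OF _ homog_unit, of s f] by simp

lemma homog_alternating: "homog s f \<Longrightarrow> alternating f"
  by (simp add: homog_def)

lemma homog_commute: "homog s f \<Longrightarrow> homog t g \<Longrightarrow> conv g f = neg_if (\<not> (s \<and> t)) (conv f g)"
  using conv_commute[of t g s f] by (simp add: homog_def conj_commute)

lemma homog_leibniz:
  "homog s f \<Longrightarrow> homog t g \<Longrightarrow> homog r h \<Longrightarrow>
    conv f (conv g h) = conv (conv f g) h + neg_if (s \<and> t) (conv g (conv f h))"
  using conv_leibniz[of s f t g r h] by (simp add: homog_def)

lemma homog_ins_conv:
  "homog x X \<Longrightarrow> homog s f \<Longrightarrow> homog t g \<Longrightarrow>
    ins X (conv f g) = conv (ins X f) g + neg_if (\<not> x \<and> s) (conv f (ins X g))"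
  using ins_conv[of x X s f g] by (simp add: homog_def)

lemma homog_pre_lie:
  "homog x X \<Longrightarrow> homog y Y \<Longrightarrow> homog s f \<Longrightarrow>
   ins X (ins Y f) = neg_if (\<not> x \<and> \<not> y) (ins Y (ins X f)) + ins (ins X Y) f
     + neg_if (x \<or> y) (ins (ins Y X) f)"
  using ins_pre_lie[of x X y Y f] by (simp add: homog_def)

text \<open>The shuffle sum \<open>insert_action\<close> with the roles reversed
  (\<open>insert_action_eq\<close>): the acting map comes first.\<close>

definition act :: "('g list \<Rightarrow> 'g) \<Rightarrow> ('g list \<Rightarrow> 'g) \<Rightarrow> 'g list \<Rightarrow> 'g" where
  "act P Q = ins (conv P unit_cochain) Q"

text \<open>The parities are separate arguments because the zero map does not determine its
  own.\<close>

definition br2 :: "bool \<Rightarrow> ('g list \<Rightarrow> 'g) \<Rightarrow> bool \<Rightarrow> ('g list \<Rightarrow> 'g) \<Rightarrow> 'g list \<Rightarrow> 'g" where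
  "br2 s P t Q = act Q P - neg_if (s \<and> t) (act P Q) + neg_if (s \<and> t) (conv P Q)"

text \<open>The six terms of the ternary bracket coincide in pairs, which absorbs the factor 1/2;
  the minus sign of \<open>H = -\<mu>\<close> is part of the signs below.\<close>

definition br3 :: "bool \<Rightarrow> ('g list \<Rightarrow> 'g) \<Rightarrow> bool \<Rightarrow> ('g list \<Rightarrow> 'g) \<Rightarrow>
    bool \<Rightarrow> ('g list \<Rightarrow> 'g) \<Rightarrow> 'g list \<Rightarrow> 'g" where
  "br3 s P t Q r R = neg_if (s \<noteq> (t \<and> r)) (ins (conv Q R) P)
     - neg_if (t \<noteq> (s \<and> (t \<noteq> r))) (ins (conv P R) Q)
     + neg_if (r \<noteq> ((s \<and> t) \<noteq> (r \<and> (s \<noteq> t)))) (ins (conv P Q) R)"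

lemma homog_act: "homog s P \<Longrightarrow> homog t Q \<Longrightarrow> homog (s \<noteq> t) (act P Q)"
  unfolding act_def using homog_ins[OF homog_conv_unit, of s P t Q] by (cases s) simp_all

lemmas act_hom = ins_hom[of "conv P unit_cochain" for P, folded act_def]

lemma act_hom_left:
  assumes "alternating Q"
  shows "act (P + P') Q = act P Q + act P' Q"
    and "act (P - P') Q = act P Q - act P' Q"
    and "act (- P) Q = - act P Q"
    and "act (neg_if b P) Q = neg_if b (act P Q)"
  using assms by (simp_all add: act_def conv_hom ins_hom_left)

lemma act_conv:
  "homog s P \<Longrightarrow> homog t Q \<Longrightarrow> homog r R \<Longrightarrow>
    act P (conv Q R) = conv (act P Q) R + neg_if (s \<and> t) (conv Q (act P R))"
  unfolding act_def using homog_ins_conv[OF homog_conv_unit, of s P t Q r R] by simp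

text \<open>Up to sign, \<open>act\<close> is a representation of the graded Lie algebra given by \<open>br2\<close>.\<close>

lemma act_act:
  assumes P: "homog s P" and Q: "homog t Q" and R: "homog r R"
  shows "act P (act Q R) = neg_if (s \<and> t) (act Q (act P R)) + act (act P Q) R
     - neg_if (s \<and> t) (act (act Q P) R) - act (conv P Q) R"
proof -
  note P' = homog_conv_unit[OF P] and Q' = homog_conv_unit[OF Q]
  \<comment> \<open>The derivation \<open>act P\<close> sends the identity cochain to
    \<open>conv P unit_cochain\<close>, by \<open>ins_unit\<close>.\<close>
  have *: "act P (conv Q unit_cochain) = conv (act P Q) unit_cochain + neg_if (s \<and> t) (conv Q (conv P unit_cochain))"
    if "homog s P" "homog t Q" for s P t Q
    using act_conv[OF that homog_unit] by (simp add: act_def ins_unit)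
  \<comment> \<open>The Jacobi identity with the identity cochain as third factor; it produces the
    term \<open>act (conv P Q) R\<close>.\<close>
  have c: "conv P (conv Q unit_cochain) = conv (conv P Q) unit_cochain + neg_if (s \<and> t) (conv Q (conv P unit_cochain))"
    by (rule homog_leibniz[OF P Q homog_unit])
  show ?thesis
    unfolding homog_pre_lie[OF P' Q' R, folded act_def] *[OF P Q] *[OF Q P]
    using homog_alternating[OF R]
    by (cases s; cases t) (simp_all add: c act_def conv_hom ins_hom_left algebra_simps)
qed

text \<open>The list holds labels to which \<open>d\<close> and \<open>X\<close> attach a degree and
  a cochain. Nested actions cancel by \<open>act_act\<close>, actions on products by the derivation
  law, and triple products by the graded Jacobi identity.\<close>

lemma jacobi3:
  assumes P: "homog (odd (d a)) (X a)" and Q: "homog (odd (d b)) (X b)" and R: "homog (odd (d c)) (X c)"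
  shows "unshuffle3 d [a, b, c] (\<lambda>xs ys zs. only_if (length xs = 2 \<and> length ys = 1 \<and> length zs = 0)
    (br2 (odd (d (xs ! 0) + d (xs ! 1))) (br2 (odd (d (xs ! 0))) (X (xs ! 0)) (odd (d (xs ! 1))) (X (xs ! 1)))
       (odd (d (ys ! 0))) (X (ys ! 0)))) = 0"
proof -
  note hom = act_hom conv_hom act_hom_left[OF homog_alternating[OF P]]
    act_hom_left[OF homog_alternating[OF Q]] act_hom_left[OF homog_alternating[OF R]]
  note a = act_act[OF P Q R] act_act[OF P R Q] act_act[OF Q R P]
  note b = homog_commute[OF P homog_act[OF Q R]] homog_commute[OF P homog_act[OF R Q]]
     homog_commute[OF Q homog_act[OF P R]] homog_commute[OF Q homog_act[OF R P]]
     homog_commute[OF R homog_act[OF P Q]] homog_commute[OF R homog_act[OF Q P]]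
  note c = homog_commute[OF P Q] homog_commute[OF P R] homog_commute[OF Q R]
    homog_commute[OF Q homog_conv[OF P R]] homog_commute[OF P homog_conv[OF Q R]]
  note j = homog_leibniz[OF P Q R]
  note e = act_conv[OF P Q R] act_conv[OF Q P R] act_conv[OF R P Q]
  show ?thesis
    unfolding br2_def
    by (simp add: only_if_def swap_parity_def)
      (cases "even (d a)"; cases "even (d b)"; cases "even (d c)"; simp add: hom a b c e j algebra_simps)
qed

text \<open>The pre-Lie law for \<open>conv S unit_cochain\<close> and \<open>conv Q R\<close>:
  \<open>act S\<close> is a derivation of the latter, and inserting the latter into the former gives
  the last two terms, through \<open>ins_unit\<close>.\<close>

lemma act_ins_conv:
  assumes P: "homog s P" and Q: "homog t Q" and R: "homog r R" and S: "homog x S"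
  shows "act S (ins (conv Q R) P) = neg_if (x \<and> t = r) (ins (conv Q R) (act S P))
     + ins (conv (act S Q) R) P + neg_if ((x \<and> t) \<noteq> (\<not> (t \<and> (x \<noteq> r)))) (ins (conv (act S R) Q) P)
     - neg_if (x \<and> t = r) (act (ins (conv Q R) S) P)
     - ins (conv S (conv Q R)) P"
proof -
  note S' = homog_conv_unit[OF S] and QR = homog_conv[OF Q R]
  note 1 = homog_pre_lie[OF S' QR P, folded act_def[of S]]
  note 2 = act_conv[OF S Q R] homog_commute[OF homog_act[OF S R] Q]
  note 3 = homog_ins_conv[OF QR S homog_unit]
  show ?thesis
    unfolding 1 2 3 ins_unit using homog_alternating[OF P]
    by (cases x; cases t; cases r) (simp_all add: conv_hom ins_hom_left act_def[of "ins (conv Q R) S"] algebra_simps)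
qed

text \<open>The derivation law with the second term commuted, so that the factor containing the
  insertion always stands on the left; this normal form is used in \<open>jacobi4\<close>.\<close>

lemma ins_conv_conv:
  assumes P: "homog s P" and Q: "homog t Q" and R: "homog r R" and S: "homog x S"
  shows "ins (conv R S) (conv P Q) = conv (ins (conv R S) P) Q
    + neg_if ((r = x \<and> s) \<noteq> (\<not> (s \<and> t \<noteq> (r = x)))) (conv (ins (conv R S) Q) P)"
proof -
  note RS = homog_conv[OF R S]
  show ?thesis
    unfolding homog_ins_conv[OF RS P Q] homog_commute[OF homog_ins[OF RS Q] P]
    by (cases s; cases t; cases r; cases x) (simp_all)
qed

text \<open>For rewriting: the occurring products of three maps are reduced to
  \<open>conv (conv X Y) Z\<close> and \<open>conv (conv X Z) Y\<close>.\<close>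

lemma conv_triple:
  assumes X: "homog s X" and Y: "homog t Y" and Z: "homog r Z"
  shows "conv X (conv Y Z) = conv (conv X Y) Z + neg_if (s \<and> t) (conv Y (conv X Z))"
    and "conv Y (conv X Z) = neg_if (\<not> ((s \<noteq> r) \<and> t)) (conv (conv X Z) Y)"
    and "conv Z (conv X Y) = neg_if (\<not> ((s \<noteq> t) \<and> r)) (conv (conv X Y) Z)"
    and "conv (conv Y Z) X = neg_if (\<not> (s \<and> (t \<noteq> r))) (conv X (conv Y Z))"
  by (rule homog_leibniz homog_commute homog_conv assms)+

text \<open>For \<open>n = 4\<close> the sign \<open>(-1) ^ (i * (n - i))\<close> is + for
  \<open>i = 2\<close> and - for \<open>i = 3\<close>, so the identity is an equality of two sums.
  They are compared after \<open>act_ins_conv\<close> has moved the actions inside the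
  insertions.\<close>

lemma jacobi4:
  assumes P: "homog (odd (d a)) (X a)" and Q: "homog (odd (d b)) (X b)"
    and R: "homog (odd (d c)) (X c)" and S: "homog (odd (d e)) (X e)"
  shows "unshuffle3 d [a, b, c, e] (\<lambda>xs ys zs. only_if (length xs = 2 \<and> length ys = 2 \<and> length zs = 0)
      (br3 (odd (d (xs ! 0) + d (xs ! 1))) (br2 (odd (d (xs ! 0))) (X (xs ! 0)) (odd (d (xs ! 1))) (X (xs ! 1)))
        (odd (d (ys ! 0))) (X (ys ! 0)) (odd (d (ys ! 1))) (X (ys ! 1)))) =
    unshuffle3 d [a, b, c, e] (\<lambda>xs ys zs. only_if (length xs = 3 \<and> length ys = 1 \<and> length zs = 0)
      (br2 (even (d (xs ! 0) + d (xs ! 1) + d (xs ! 2)))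
        (br3 (odd (d (xs ! 0))) (X (xs ! 0)) (odd (d (xs ! 1))) (X (xs ! 1)) (odd (d (xs ! 2))) (X (xs ! 2)))
        (odd (d (ys ! 0))) (X (ys ! 0))))"
proof -
  note alt = homog_alternating[OF P] homog_alternating[OF Q] homog_alternating[OF R] homog_alternating[OF S]
  note hom = act_hom conv_hom ins_hom alt[THEN act_hom_left(1)] alt[THEN act_hom_left(2)]
    alt[THEN act_hom_left(3)] alt[THEN act_hom_left(4)]
    alt[THEN ins_hom_left(1)] alt[THEN ins_hom_left(2)] alt[THEN ins_hom_left(3)]
    alt[THEN ins_hom_left(4)] alt[THEN ins_hom_left(5)]
  \<comment> \<open>One instance for each acting map and each outer map among the other three, hence
    twelve.\<close>
  note swap =
    act_ins_conv[OF P Q R S] act_ins_conv[OF Q P R S] act_ins_conv[OF R P Q S]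
    act_ins_conv[OF P Q S R] act_ins_conv[OF Q P S R] act_ins_conv[OF S P Q R]
    act_ins_conv[OF P R S Q] act_ins_conv[OF R P S Q] act_ins_conv[OF S P R Q]
    act_ins_conv[OF Q R S P] act_ins_conv[OF R Q S P] act_ins_conv[OF S Q R P]
  note deriv = ins_conv_conv[OF P Q R S] ins_conv_conv[OF P R Q S] ins_conv_conv[OF P S Q R]
    ins_conv_conv[OF Q R P S] ins_conv_conv[OF Q S P R] ins_conv_conv[OF R S P Q]
  note lie = conv_triple[OF P Q R] conv_triple[OF P Q S] conv_triple[OF P R S] conv_triple[OF Q R S]
  show ?thesis
    unfolding br2_def br3_def
    by (simp add: only_if_def swap_parity_def)
      (cases "even (d a)"; cases "even (d b)"; cases "even (d c)"; cases "even (d e)";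
        simp add: hom swap deriv lie algebra_simps)
qed

text \<open>The pre-Lie law for two inserted products, with insertions into a product expanded by
  the derivation law.\<close>

lemma ins_conv_ins_conv:
  assumes P: "homog s P" and Q: "homog t Q" and R: "homog r R" and S: "homog x S" and T: "homog y T"
  shows "ins (conv S T) (ins (conv Q R) P) =
      neg_if (x = y \<and> t = r) (ins (conv Q R) (ins (conv S T) P))
    + ins (conv (ins (conv S T) Q) R) P
    + neg_if ((x = y \<and> t) \<noteq> (\<not> (t \<and> r \<noteq> (x = y)))) (ins (conv (ins (conv S T) R) Q) P)
    - neg_if (x = y \<and> t = r) (ins (conv (ins (conv Q R) S) T) P)
    - neg_if ((x = y \<and> t = r) \<noteq> ((t = r \<and> x) \<noteq> (\<not> (x \<and> y \<noteq> (t = r))))) (ins (conv (ins (conv Q R) T) S) P)"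
proof -
  note QR = homog_conv[OF Q R] and ST = homog_conv[OF S T]
  show ?thesis
    unfolding homog_pre_lie[OF ST QR P] ins_conv_conv[OF Q R S T] ins_conv_conv[OF S T Q R]
    using homog_alternating[OF P]
    by (cases "x = y"; cases "t = r"; cases t; cases x) (simp_all add: ins_hom_left algebra_simps)
qed

lemma jacobi5:
  assumes P: "homog (odd (d a)) (X a)" and Q: "homog (odd (d b)) (X b)"
    and R: "homog (odd (d c)) (X c)" and S: "homog (odd (d e)) (X e)" and T: "homog (odd (d f)) (X f)"
  shows "unshuffle3 d [a, b, c, e, f] (\<lambda>xs ys zs. only_if (length xs = 3 \<and> length ys = 2 \<and> length zs = 0)
      (br3 (even (d (xs ! 0) + d (xs ! 1) + d (xs ! 2)))
        (br3 (odd (d (xs ! 0))) (X (xs ! 0)) (odd (d (xs ! 1))) (X (xs ! 1)) (odd (d (xs ! 2))) (X (xs ! 2)))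
        (odd (d (ys ! 0))) (X (ys ! 0)) (odd (d (ys ! 1))) (X (ys ! 1)))) = 0"
proof -
  note alt = homog_alternating[OF P] homog_alternating[OF Q] homog_alternating[OF R]
    homog_alternating[OF S] homog_alternating[OF T]
  note hom = conv_hom ins_hom alt[THEN ins_hom_left(1)] alt[THEN ins_hom_left(2)]
    alt[THEN ins_hom_left(3)] alt[THEN ins_hom_left(4)] alt[THEN ins_hom_left(5)]
  \<comment> \<open>Five outer maps and three pairings of the other four give fifteen instances.
    Each pairing occurs in one orientation only, since the reverse instance would rewrite
    back.\<close>
  note swap = ins_conv_ins_conv[OF P Q R S T] ins_conv_ins_conv[OF P Q S R T] ins_conv_ins_conv[OF P Q T R S]
     ins_conv_ins_conv[OF Q P R S T] ins_conv_ins_conv[OF Q P S R T] ins_conv_ins_conv[OF Q P T R S]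
     ins_conv_ins_conv[OF R P Q S T] ins_conv_ins_conv[OF R P S Q T] ins_conv_ins_conv[OF R P T Q S]
     ins_conv_ins_conv[OF S P Q R T] ins_conv_ins_conv[OF S P R Q T] ins_conv_ins_conv[OF S P T Q R]
     ins_conv_ins_conv[OF T P Q R S] ins_conv_ins_conv[OF T P R Q S] ins_conv_ins_conv[OF T P S Q R]
  show ?thesis
    unfolding br3_def
    by (simp add: only_if_def swap_parity_def)
      (cases "even (d a)"; cases "even (d b)"; cases "even (d c)"; cases "even (d e)"; cases "even (d f)";
        simp add: hom swap algebra_simps)
qed

end

section \<open>The brackets in terms of products and insertions\<close>

text \<open>This permits replacing a negative degree by a nonnegative one of the same
  parity.\<close>

lemma koszul_sign_cong:
  assumes "\<sigma> permutes {..<n}" "\<And>i. i < n \<Longrightarrow> even (d i) = even (d' i)"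
  shows "koszul_sign n d \<sigma> = koszul_sign n d' \<sigma>"
  unfolding koszul_sign_def
proof (intro prod.cong refl)
  fix p assume p: "p \<in> {(i, j). i < j \<and> j < n \<and> \<sigma> j < \<sigma> i}"
  then obtain i j where ij: "p = (i, j)" "i < j" "j < n" by auto
  then have "\<sigma> i < n" "\<sigma> j < n" using permutes_in_image[OF assms(1)] by auto
  then show "(case p of (i, j) \<Rightarrow> if even (d (\<sigma> i) * d (\<sigma> j)) then 1 else - 1) =
      (case p of (i, j) \<Rightarrow> if even (d' (\<sigma> i) * d' (\<sigma> j)) then 1 else - (1::int))"
    using ij assms(2) by simp
qed

lemma shuffle_weight_upt:
  assumes "\<sigma> permutes {..<n}" "\<And>i. i < n \<Longrightarrow> even (d i) = even (d' i)"
  shows "shuffle_weight d' [0..<n] \<sigma> = sign \<sigma> * koszul_sign n d \<sigma>"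
proof -
  have "koszul_sign n (\<lambda>i. d' ([0..<n] ! i)) \<sigma> = koszul_sign n d \<sigma>"
    by (rule koszul_sign_cong[OF assms(1)]) (simp add: assms(2))
  then show ?thesis by (simp add: shuffle_weight_def)
qed

lemma shuffle_weight_zero: "shuffle_weight (\<lambda>_. 0) us \<sigma> = sign \<sigma>"
  by (simp add: shuffle_weight_def koszul_sign_def)

lemma length_block [simp]: "length (block us \<sigma> a b) = b - a"
  by (simp add: block_def)

lemma (in vector_space) scale_sign: "scale ((-1) ^ n) x = neg_if (odd n) x"
  by (simp add: neg_if_def)

lemma (in vector_space) sum_Sh2_eq_unshuffle3:
  assumes "length us = a + b"
  shows "(\<Sum>\<sigma>\<in>Sh2 a b. scale (of_int (shuffle_weight d us \<sigma>))
      (F (block us \<sigma> 0 a) (block us \<sigma> a (a + b)))) =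
    unshuffle3 d us (\<lambda>xs ys zs. only_if (length xs = a \<and> length ys = b \<and> length zs = 0) (F xs ys))"
  using sum_Sh3_eq_unshuffle3[of us a b 0 d "\<lambda>xs ys zs. F xs ys"] assms by (simp only: Sh2_eq_Sh3 add_0_right)

lemma component_add: "component n (P + Q) = component n P + component n (Q :: _ \<Rightarrow> 'b::ab_group_add)"
  by (auto simp: component_def fun_eq_iff)

context lie_algebra begin

section \<open>Alternating maps of a fixed degree\<close>

lemma vector_space_cochain: "vector_space (cochain_scale scale :: 'k \<Rightarrow> ('m list \<Rightarrow> 'g) \<Rightarrow> _)"
  by unfold_locales
    (auto simp: cochain_scale_def fun_eq_iff scale_right_distrib scale_left_distrib)

lemma alternating_repeated:
  assumes "alternating f"
  shows "f (xs @ y # ys @ y # zs) = 0"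
proof (induction ys arbitrary: xs)
  case Nil
  then show ?case by (simp add: alternatingD[OF assms])
next
  case (Cons z ys)
  then show ?case using alternating_swap[OF assms, of xs y z "ys @ y # zs"] Cons[of "xs @ [z]"] by simp
qed

text \<open>Outside length \<open>n\<close> all values are 0 and the laws hold trivially, so they
  may be demanded for lists of every length; \<open>alternating_repeated\<close> bridges adjacent
  and arbitrary repetitions.\<close>

lemma Hom_wedge_iff:
  "P \<in> Hom_wedge scale scale n \<longleftrightarrow> alternating P \<and> (\<forall>us. length us \<noteq> n \<longrightarrow> P us = 0)"
proof
  assume P: "P \<in> Hom_wedge scale scale n"
  then have 0: "P us = 0" if "length us \<noteq> n \<or> \<not> distinct us" for us
    using that by (auto simp: Hom_wedge_def)
  have "P (xs @ (x + y) # ys) = P (xs @ x # ys) + P (xs @ y # ys) \<and>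
      P (xs @ scale c x # ys) = scale c (P (xs @ x # ys))" for xs ys x y c
    using P 0 by (cases "length xs + 1 + length ys = n") (auto simp: Hom_wedge_def multilinear_on_def)
  then show "alternating P \<and> (\<forall>us. length us \<noteq> n \<longrightarrow> P us = 0)"
    using 0 by (auto simp: alternating_def)
next
  assume P: "alternating P \<and> (\<forall>us. length us \<noteq> n \<longrightarrow> P us = 0)"
  have "P us = 0" if "\<not> distinct us" for us
    using not_distinct_decomp[OF that] alternating_repeated[of P] P by fastforce
  then show "P \<in> Hom_wedge scale scale n"
    using P by (auto simp: Hom_wedge_def multilinear_on_def alternating_def)
qed

abbreviation Hom :: "nat \<Rightarrow> ('g list \<Rightarrow> 'g) set" where
  "Hom \<equiv> Hom_wedge scale scale"

lemma HomD: "P \<in> Hom n \<Longrightarrow> alternating P" "P \<in> Hom n \<Longrightarrow> length us \<noteq> n \<Longrightarrow> P us = 0"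
  by (auto simp: Hom_wedge_iff)

lemma Hom_homog: "P \<in> Hom n \<Longrightarrow> homog (odd n) P"
  by (auto simp: Hom_wedge_iff homog_def parity_def)

lemma Hom_zero: "0 \<in> Hom n"
  by (simp add: Hom_wedge_iff alternating_zero)

lemma Hom_add: "P \<in> Hom n \<Longrightarrow> Q \<in> Hom n \<Longrightarrow> P + Q \<in> Hom n"
  by (simp add: Hom_wedge_iff alternating_add)

lemma Hom_neg_if: "P \<in> Hom n \<Longrightarrow> neg_if b P \<in> Hom n"
  by (auto simp: Hom_wedge_iff alternating_neg_if neg_if_fun)

lemma Hom_diff: "P \<in> Hom n \<Longrightarrow> Q \<in> Hom n \<Longrightarrow> P - Q \<in> Hom n"
  using Hom_add[of P n "neg_if True Q"] Hom_neg_if[of Q n True] by simp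

lemma Hom_scale: "P \<in> Hom n \<Longrightarrow> cochain_scale scale c P \<in> Hom n"
  by (simp add: Hom_wedge_iff alternating_scale) (simp add: cochain_scale_def)

lemma Hom_unit: "unit_cochain \<in> Hom 1"
  by (simp add: Hom_wedge_iff alternating_unit) (simp add: unit_cochain_def linear_cochain_def)

lemma Hom_conv:
  assumes "P \<in> Hom p" "Q \<in> Hom q"
  shows "conv P Q \<in> Hom (p + q)"
proof -
  have "conv P Q us = 0" if "length us \<noteq> p + q" for us
  proof -
    have "conv P Q us = unshuffle2 us (\<lambda>xs ys. 0)"
      unfolding conv_def
    proof (rule unshuffle2_cong)
      fix xs ys :: "'g list" assume "length xs + length ys = length us"
      with that have "length xs \<noteq> p \<or> length ys \<noteq> q" by auto
      then show "bracket (P xs) (Q ys) = 0"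
        using HomD(2)[OF assms(1)] HomD(2)[OF assms(2)] by (auto simp: bracket_simps)
    qed
    then show ?thesis by simp
  qed
  then show ?thesis using assms by (simp add: Hom_wedge_iff alternating_conv)
qed

text \<open>Writing \<open>Suc (length us)\<close> avoids a truncated \<open>x + p - 1\<close>,
  which matters for \<open>x = p = 0\<close>.\<close>

lemma ins_Hom_eq_0:
  assumes X: "X \<in> Hom x" and P: "P \<in> Hom p" and us: "Suc (length us) \<noteq> x + p"
  shows "ins X P us = 0"
proof -
  have "ins X P us = unshuffle2 us (\<lambda>xs ys. 0)"
    unfolding ins_def
  proof (rule unshuffle2_cong)
    fix xs ys :: "'g list" assume "length xs + length ys = length us"
    with us have "length xs \<noteq> x \<or> Suc (length ys) \<noteq> p" by auto
    then show "P (X xs # ys) = 0"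
      using HomD(2)[OF X] HomD[OF P] by (auto simp: alternating_head)
  qed
  then show ?thesis by simp
qed

lemma Hom_ins:
  assumes "X \<in> Hom x" "P \<in> Hom p" "Suc n = x + p"
  shows "ins X P \<in> Hom n"
  unfolding Hom_wedge_iff[of _ n]
  using ins_Hom_eq_0[OF assms(1,2)] assms alternating_ins[OF HomD(1)[OF assms(1)] HomD(1)[OF assms(2)]] by simp

lemma Hom_act: "P \<in> Hom p \<Longrightarrow> Q \<in> Hom q \<Longrightarrow> act P Q \<in> Hom (p + q)"
  unfolding act_def by (rule Hom_ins[OF Hom_conv[OF _ Hom_unit]]) auto

lemma Hom_br2: "P \<in> Hom p \<Longrightarrow> Q \<in> Hom q \<Longrightarrow> br2 s P t Q \<in> Hom (p + q)"
  unfolding br2_def using Hom_act[of P p Q q] Hom_act[of Q q P p] Hom_conv[of P p Q q]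
  by (simp add: Hom_add Hom_diff Hom_neg_if add.commute)

lemma ins_conv_eq_0: "P \<in> Hom 0 \<Longrightarrow> Q \<in> Hom 0 \<Longrightarrow> R \<in> Hom 0 \<Longrightarrow> ins (conv P Q) R = 0"
  using ins_Hom_eq_0[OF Hom_conv[of P 0 Q 0], of R 0] by (auto simp: fun_eq_iff)

text \<open>The formal degree is -1: a map without arguments admits no insertion. The case stands
  alone because natural numbers would truncate this degree to 0.\<close>

lemma br3_eq_0: "P \<in> Hom 0 \<Longrightarrow> Q \<in> Hom 0 \<Longrightarrow> R \<in> Hom 0 \<Longrightarrow> br3 s P t Q u R = 0"
  by (simp add: br3_def ins_conv_eq_0)

lemma Hom_br3:
  assumes "P \<in> Hom p" "Q \<in> Hom q" "R \<in> Hom r" "p + q + r = Suc n"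
  shows "br3 s P t Q u R \<in> Hom n"
proof -
  have *: "ins (conv P' Q') R' \<in> Hom n"
    if "P' \<in> Hom p'" "Q' \<in> Hom q'" "R' \<in> Hom r'" "p' + q' + r' = Suc n" for P' Q' R' p' q' r'
    using that(4) by (intro Hom_ins[OF Hom_conv[OF that(1,2)] that(3)]) simp
  show ?thesis
    unfolding br3_def
    by (intro Hom_add Hom_diff Hom_neg_if *[OF assms(2,3,1)] *[OF assms(1,3,2)] *[OF assms(1-3)])
      (use assms(4) in simp_all)
qed

lemma Hom_br3_parity:
  assumes "P \<in> Hom p" "Q \<in> Hom q" "R \<in> Hom r"
  obtains n where "br3 s P t Q u R \<in> Hom n" "odd n \<longleftrightarrow> even (p + q + r)"
proof (cases "p + q + r")
  case 0
  \<comment> \<open>Zero lies in every \<open>Hom n\<close>; 1 is chosen because it has the parity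
    of the formal degree -1.\<close>
  then have "br3 s P t Q u R \<in> Hom 1" using br3_eq_0[of P Q R] assms by (simp add: Hom_zero)
  then show ?thesis using 0 by (intro that[of 1]) auto
next
  case (Suc n)
  then show ?thesis using Hom_br3[OF assms Suc] by (intro that[of n]) auto
qed

text \<open>Since \<open>P\<close> and \<open>Q\<close> vanish on lists of other lengths, the length
  guards of the unshuffle sum hold automatically where it matters, except that the third block has
  to be empty.\<close>

lemma sum_Sh2_conv:
  assumes P: "P \<in> Hom p" and Q: "Q \<in> Hom q" and us: "length us = p + q"
  shows "(\<Sum>\<sigma>\<in>Sh2 p q. scale (of_int (sign \<sigma>)) (bracket (P (block us \<sigma> 0 p)) (Q (block us \<sigma> p (p + q))))) =
    conv P Q us"
proof -
  have *: "only_if (length xs = p \<and> length ys = q \<and> length zs = 0) (bracket (P xs) (Q ys)) =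
      only_if (zs = []) (bracket (P xs) (Q ys))" for xs ys zs :: "'g list"
    using HomD(2)[OF P] HomD(2)[OF Q] by (auto simp: only_if_def bracket_simps)
  have **: "unshuffle2 ws (\<lambda>xs ys. only_if b (bracket (P xs) (Q ys))) = only_if b (conv P Q ws)" for ws b
    by (simp add: only_if_def conv_def)
  show ?thesis
    using sum_Sh2_eq_unshuffle3[OF us, of "\<lambda>_. 0" "\<lambda>xs ys. bracket (P xs) (Q ys)"]
    unfolding shuffle_weight_zero * unshuffle3_eq_unshuffle2 ** unshuffle2_right_Nil by simp
qed

lemma sum_Sh3_insert:
  assumes P: "P \<in> Hom p" and Q: "Q \<in> Hom q" and R: "R \<in> Hom r" and us: "Suc (length us) = p + q + r"
  shows "(\<Sum>\<sigma>\<in>Sh3 q r (int p - 1). scale (of_int (sign \<sigma>))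
    (P (bracket (Q (block us \<sigma> 0 q)) (R (block us \<sigma> q (q + r))) # block us \<sigma> (q + r) (p + q + r - 1)))) =
    ins (conv Q R) P us"
proof (cases p)
  case 0
  \<comment> \<open>The set of (q, r, -1)-shuffles is empty, and a map without arguments vanishes on
    the nonempty list headed by the inserted value.\<close>
  then have "ins (conv Q R) P us = unshuffle2 us (\<lambda>xs ys. 0)"
    unfolding ins_def using HomD(2)[OF P] by (intro unshuffle2_cong) simp
  moreover have "Sh3 q r (- 1) = {}" by (simp add: Sh3_def)
  ultimately show ?thesis using 0 by simp
next
  case (Suc n)
  have len: "length us = q + r + n" and n: "p + q + r - 1 = q + r + n" and p: "int p - 1 = int n"
    using us Suc by simp_all
  have *: "only_if (length xs = q \<and> length ys = r \<and> length zs = n) (P (bracket (Q xs) (R ys) # zs)) =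
      P (bracket (Q xs) (R ys) # zs)" for xs ys zs :: "'g list"
    using HomD(2)[OF P, of "_ # zs"] HomD(2)[OF Q] HomD(2)[OF R] alternating_head(4)[OF HomD(1)[OF P]]
    by (auto simp: only_if_def bracket_simps Suc)
  \<comment> \<open>Additivity of \<open>P\<close> in its first slot moves it inside the sum
    defining \<open>conv Q R\<close>.\<close>
  show ?thesis
    unfolding n p
    using sum_Sh3_eq_unshuffle3[OF len, of "\<lambda>_. 0" "\<lambda>xs ys zs. P (bracket (Q xs) (R ys) # zs)"]
    unfolding shuffle_weight_zero * unshuffle3_eq_unshuffle2 ins_def conv_def
    by (simp add: unshuffle2_hom[OF alternating_additive[OF HomD(1)[OF P]]])
qed

text \<open>The block of size one is the argument of the identity cochain, so the action term is the
  case of \<open>sum_Sh3_insert\<close> with the identity as third map.\<close>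

lemma insert_action_eq:
  assumes P: "P \<in> Hom p" and Q: "Q \<in> Hom q" and us: "length us = p + q"
  shows "insert_action scale bracket p P q Q us = act Q P us"
proof -
  have "unit_cochain (block us \<sigma> q (q + 1)) = us ! \<sigma> q" for \<sigma>
    by (simp add: block_def unit_cochain_def linear_cochain_def)
  then show ?thesis
    using sum_Sh3_insert[OF P Q Hom_unit, of us] us
    by (simp add: insert_action_def act_def)
qed

lemma insert_cocycle_eq:
  assumes P: "P \<in> Hom p" and Q: "Q \<in> Hom q" and R: "R \<in> Hom r" and us: "Suc (length us) = p + q + r"
  shows "insert_cocycle scale (\<lambda>x y. - bracket x y) p P q Q r R us = - ins (conv Q R) P us"
  unfolding sum_Sh3_insert[OF assms, symmetric] insert_cocycle_def
  by (simp add: alternating_head[OF HomD(1)[OF P]] sum_negf)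

lemma hom_bracket2_eq:
  assumes "P \<in> Hom p" "Q \<in> Hom q" "length us = p + q"
  shows "hom_bracket2 scale bracket bracket p P q Q us = br2 (odd p) P (odd q) Q us"
  using assms insert_action_eq[OF assms(2,1)]
  by (simp add: hom_bracket2_def insert_action_eq sum_Sh2_conv scale_sign br2_def neg_if_fun)

text \<open>When the two inner maps are exchanged, the sign from \<open>homog_commute\<close>
  cancels the relative sign in the formula. The six terms are thus \<open>br3\<close> taken twice,
  and 2 has to be invertible.\<close>

lemma hom_bracket3_eq:
  assumes two: "(2::'k) \<noteq> 0"
    and P: "P \<in> Hom p" and Q: "Q \<in> Hom q" and R: "R \<in> Hom r" and us: "Suc (length us) = p + q + r"
  shows "hom_bracket3 scale (\<lambda>x y. - bracket x y) p P q Q r R us = br3 (odd p) P (odd q) Q (odd r) R us"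
proof -
  have half: "scale (1 / 2) (x + x) = x" for x
  proof -
    have "x + x = scale 2 x" using scale_left_distrib[of 1 1 x] by simp
    then show ?thesis by (simp only: scale_scale) (simp add: two)
  qed
  have e: "insert_cocycle scale (\<lambda>x y. - bracket x y) p P q Q r R us = - ins (conv Q R) P us"
    "insert_cocycle scale (\<lambda>x y. - bracket x y) p P r R q Q us = - ins (conv R Q) P us"
    "insert_cocycle scale (\<lambda>x y. - bracket x y) q Q p P r R us = - ins (conv P R) Q us"
    "insert_cocycle scale (\<lambda>x y. - bracket x y) q Q r R p P us = - ins (conv R P) Q us"
    "insert_cocycle scale (\<lambda>x y. - bracket x y) r R p P q Q us = - ins (conv P Q) R us"
    "insert_cocycle scale (\<lambda>x y. - bracket x y) r R q Q p P us = - ins (conv Q P) R us"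
    using us by (intro insert_cocycle_eq P Q R; simp)+
  note c = homog_commute[OF Hom_homog[OF P] Hom_homog[OF Q]]
    homog_commute[OF Hom_homog[OF P] Hom_homog[OF R]] homog_commute[OF Hom_homog[OF Q] Hom_homog[OF R]]
  note hom = HomD(1)[OF P, THEN ins_hom_left(5)] HomD(1)[OF Q, THEN ins_hom_left(5)]
    HomD(1)[OF R, THEN ins_hom_left(5)]
  have "hom_bracket3 scale (\<lambda>x y. - bracket x y) p P q Q r R us =
    scale (1 / 2) (br3 (odd p) P (odd q) Q (odd r) R us + br3 (odd p) P (odd q) Q (odd r) R us)"
    unfolding hom_bracket3_def e c hom
    by (rule arg_cong[of _ _ "scale (1 / 2)"])
      (cases "even p"; cases "even q"; cases "even r";
        simp add: br3_def outer_sign_def minus_one_power_iff neg_if_fun algebra_simps)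
  then show ?thesis by (simp add: half)
qed

end

section \<open>Multilinearity of the brackets\<close>

lemma sum_fun_apply: "(\<Sum>i\<in>I. f i) x = (\<Sum>i\<in>I. f i x :: 'b::ab_group_add)"
  by (induction I rule: infinite_finite_induct) auto

lemma finite_sum_eq:
  "finite {(p, q). p + q = (n::nat)}" "finite {(p, q, r). p + q + r = (n::nat)}"
proof -
  show "finite {(p, q). p + q = n}"
    by (rule finite_subset[of _ "{..n} \<times> {..n}"]) auto
  show "finite {(p, q, r). p + q + r = n}"
    by (rule finite_subset[of _ "{..n} \<times> {..n} \<times> {..n}"]) auto
qed

lemma permutes_ext_permE:
  assumes "\<tau> permutes {..<Suc n}"
  obtains m \<sigma> where "m \<le> n" "\<sigma> permutes {..<n}" "\<tau> = ext_perm m \<sigma>"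
proof -
  obtain m where m: "\<tau> m = 0" using assms by (metis permutes_def)
  then have "m \<in> {..<Suc n}" using permutes_in_image[OF assms, of m] by simp
  then have "m \<le> n" by simp
  with assms m that show ?thesis using ext_perm_surj by metis
qed

context lie_algebra begin

lemma neg_if_cochain_scale: "neg_if b (cochain_scale scale c P) = cochain_scale scale c (neg_if b P)"
  by (auto simp: neg_if_def cochain_scale_def fun_eq_iff)

lemma cochain_scale_add: "cochain_scale scale c (P + Q) = cochain_scale scale c P + cochain_scale scale c Q"
  by (auto simp: cochain_scale_def fun_eq_iff scale_right_distrib)

lemma cochain_scale_diff: "cochain_scale scale c (P - Q) = cochain_scale scale c P - cochain_scale scale c Q"
  by (auto simp: cochain_scale_def fun_eq_iff scale_right_diff_distrib)

lemmas bracket_linear_simps = ins_hom ins_hom_left ins_scale ins_scale_left conv_hom conv_scale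
  neg_if_add neg_if_cochain_scale cochain_scale_add cochain_scale_diff

lemma br2_add:
  assumes "alternating P" "alternating P'" "alternating Q"
  shows "br2 s (P + P') t Q = br2 s P t Q + br2 s P' t Q"
    and "br2 s Q t (P + P') = br2 s Q t P + br2 s Q t P'"
  by (simp_all add: assms br2_def act_def bracket_linear_simps)

lemma br2_scale:
  assumes "alternating P" "alternating Q"
  shows "br2 s (cochain_scale scale c P) t Q = cochain_scale scale c (br2 s P t Q)"
    and "br2 s Q t (cochain_scale scale c P) = cochain_scale scale c (br2 s Q t P)"
  by (simp_all add: assms br2_def act_def bracket_linear_simps)

lemma br2_zero:
  assumes "alternating Q"
  shows "br2 s 0 t Q = 0" and "br2 s Q t 0 = 0"
  by (simp_all add: assms br2_def act_def bracket_linear_simps)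

lemma br2_commute:
  assumes "homog s P" "homog t Q"
  shows "br2 t Q s P = neg_if (\<not> (s \<and> t)) (br2 s P t Q)"
  using homog_commute[OF assms]
  by (cases s; cases t) (simp_all add: br2_def algebra_simps)

text \<open>The two adjacent transpositions, which generate all permutations of three
  arguments.\<close>

lemma br3_commute:
  assumes "homog s P" "homog t Q" "homog r R"
  shows "br3 t Q s P r R = neg_if (\<not> (s \<and> t)) (br3 s P t Q r R)"
    and "br3 s P r R t Q = neg_if (\<not> (t \<and> r)) (br3 s P t Q r R)"
  using homog_commute[OF assms(1,2)] homog_commute[OF assms(1,3)] homog_commute[OF assms(2,3)]
    homog_alternating[OF assms(1)] homog_alternating[OF assms(2)] homog_alternating[OF assms(3)]
  by (cases s; cases t; cases r; simp add: br3_def ins_hom_left algebra_simps)+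

lemma br3_add:
  assumes "alternating P" "alternating P'" "alternating Q" "alternating R"
  shows "br3 s (P + P') t Q r R = br3 s P t Q r R + br3 s P' t Q r R"
    and "br3 s Q t (P + P') r R = br3 s Q t P r R + br3 s Q t P' r R"
    and "br3 s Q t R r (P + P') = br3 s Q t R r P + br3 s Q t R r P'"
  by (simp_all add: assms br3_def bracket_linear_simps)

lemma br3_scale:
  assumes "alternating P" "alternating Q" "alternating R"
  shows "br3 s (cochain_scale scale c P) t Q r R = cochain_scale scale c (br3 s P t Q r R)"
    and "br3 s Q t (cochain_scale scale c P) r R = cochain_scale scale c (br3 s Q t P r R)"
    and "br3 s Q t R r (cochain_scale scale c P) = cochain_scale scale c (br3 s Q t R r P)"
  by (simp_all add: assms br3_def bracket_linear_simps)

lemma br3_zero: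
  assumes "alternating Q" "alternating R"
  shows "br3 s 0 t Q r R = 0" and "br3 s Q t 0 r R = 0" and "br3 s Q t R r 0 = 0"
  by (simp_all add: assms br3_def bracket_linear_simps)

text \<open>The direct product of the \<open>Hom n\<close>, not their direct sum. On each list only
  finitely many degrees contribute to a bracket, so multilinearity already holds here and restricts
  to \<open>total\<close>.\<close>

definition graded :: "('g list \<Rightarrow> 'g) set" where
  "graded = {P. \<forall>n. component n P \<in> Hom n}"

lemma component_scale: "component n (cochain_scale scale c P) = cochain_scale scale c (component n P)"
  by (auto simp: component_def cochain_scale_def fun_eq_iff)

lemma component_Hom: "P \<in> Hom p \<Longrightarrow> component n P = (if n = p then P else 0)"
  using HomD(2)[of P p] by (auto simp: component_def fun_eq_iff)

lemma Hom_graded: "P \<in> Hom p \<Longrightarrow> P \<in> graded"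
  by (simp add: graded_def component_Hom Hom_zero)

lemma bracket2_graded:
  assumes "P \<in> graded" "Q \<in> graded"
  shows "bracket2 scale bracket bracket P Q us =
    (\<Sum>(p, q)\<in>{(p, q). p + q = length us}. br2 (odd p) (component p P) (odd q) (component q Q) us)"
  unfolding bracket2_def using assms
  by (intro sum.cong) (auto simp: graded_def hom_bracket2_eq)

lemma bracket3_graded:
  assumes "(2::'k) \<noteq> 0" "P \<in> graded" "Q \<in> graded" "R \<in> graded"
  shows "bracket3 scale (\<lambda>x y. - bracket x y) P Q R us =
    (\<Sum>(p, q, r)\<in>{(p, q, r). p + q + r = length us + 1}.
      br3 (odd p) (component p P) (odd q) (component q Q) (odd r) (component r R) us)"
  unfolding bracket3_def using assms
  by (intro sum.cong) (auto simp: graded_def hom_bracket3_eq)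

lemma bracket2_Hom:
  assumes P: "P \<in> Hom p" and Q: "Q \<in> Hom q"
  shows "bracket2 scale bracket bracket P Q = br2 (odd p) P (odd q) Q"
proof
  fix us :: "'g list"
  let ?S = "{(p, q). p + q = length us}"
  let ?f = "\<lambda>(p, q). br2 (odd p) (component p P) (odd q) (component q Q) us"
  have 0: "?f z = 0" if "z \<noteq> (p, q)" for z
    using that P Q HomD(1)[OF P] HomD(1)[OF Q]
    by (cases z) (auto simp: component_Hom br2_zero alternating_zero)
  have "bracket2 scale bracket bracket P Q us = sum ?f ?S"
    by (rule bracket2_graded[OF Hom_graded[OF P] Hom_graded[OF Q]])
  also have "\<dots> = sum ?f (?S \<inter> {(p, q)})"
    by (rule sum.mono_neutral_right) (use 0 finite_sum_eq(1) in auto)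
  also have "\<dots> = br2 (odd p) P (odd q) Q us"
    using HomD(2)[OF Hom_br2[OF P Q]] P Q by (cases "p + q = length us") (auto simp: component_Hom)
  finally show "bracket2 scale bracket bracket P Q us = br2 (odd p) P (odd q) Q us" .
qed

lemma bracket3_Hom:
  assumes "(2::'k) \<noteq> 0" and P: "P \<in> Hom p" and Q: "Q \<in> Hom q" and R: "R \<in> Hom r"
  shows "bracket3 scale (\<lambda>x y. - bracket x y) P Q R = br3 (odd p) P (odd q) Q (odd r) R"
proof
  fix us :: "'g list"
  let ?S = "{(p, q, r). p + q + r = length us + 1}"
  let ?f = "\<lambda>(p, q, r). br3 (odd p) (component p P) (odd q) (component q Q) (odd r) (component r R) us"
  have 0: "?f z = 0" if "z \<noteq> (p, q, r)" for z
    using that P Q R HomD(1)[OF P] HomD(1)[OF Q] HomD(1)[OF R]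
    by (cases z) (auto simp: component_Hom br3_zero alternating_zero)
  have "bracket3 scale (\<lambda>x y. - bracket x y) P Q R us = sum ?f ?S"
    by (rule bracket3_graded[OF assms(1) Hom_graded[OF P] Hom_graded[OF Q] Hom_graded[OF R]])
  also have "\<dots> = sum ?f (?S \<inter> {(p, q, r)})"
    by (rule sum.mono_neutral_right) (use 0 finite_sum_eq(2) in auto)
  also have "\<dots> = br3 (odd p) P (odd q) Q (odd r) R us"
  proof (cases "p + q + r = length us + 1")
    case True
    then show ?thesis using P Q R by (simp add: component_Hom)
  next
    case False
    have "br3 (odd p) P (odd q) Q (odd r) R us = 0"
    proof (cases "p + q + r")
      case 0
      then show ?thesis using br3_eq_0[of P Q R] P Q R by simp
    next
      case (Suc n)
      then show ?thesis using HomD(2)[OF Hom_br3[OF P Q R Suc]] False by simp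
    qed
    then show ?thesis using False by simp
  qed
  finally show "bracket3 scale (\<lambda>x y. - bracket x y) P Q R us = br3 (odd p) P (odd q) Q (odd r) R us" .
qed

lemma graded_add: "P \<in> graded \<Longrightarrow> Q \<in> graded \<Longrightarrow> P + Q \<in> graded"
  by (simp add: graded_def component_add Hom_add)

lemma graded_scale: "P \<in> graded \<Longrightarrow> cochain_scale scale c P \<in> graded"
  by (simp add: graded_def component_scale Hom_scale)

lemma graded_alternating: "P \<in> graded \<Longrightarrow> alternating (component n P)"
  by (rule HomD(1)[of _ n]) (simp add: graded_def)

lemma multilinear_bracket2:
  "multilinear_on (cochain_scale scale) (cochain_scale scale) graded 2
    (\<lambda>xs. bracket2 scale bracket bracket (xs ! 0) (xs ! 1))"
proof -
  note g = graded_add graded_scale graded_alternating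
  have 1: "bracket2 scale bracket bracket (P + P') Q =
        bracket2 scale bracket bracket P Q + bracket2 scale bracket bracket P' Q"
      "bracket2 scale bracket bracket Q (P + P') =
        bracket2 scale bracket bracket Q P + bracket2 scale bracket bracket Q P'"
    if "P \<in> graded" "P' \<in> graded" "Q \<in> graded" for P P' Q
    using that by (auto simp: fun_eq_iff bracket2_graded g component_add br2_add
        simp flip: sum.distrib intro!: sum.cong)
  have 2: "bracket2 scale bracket bracket (cochain_scale scale c P) Q =
        cochain_scale scale c (bracket2 scale bracket bracket P Q)"
      "bracket2 scale bracket bracket Q (cochain_scale scale c P) =
        cochain_scale scale c (bracket2 scale bracket bracket Q P)"
    if "P \<in> graded" "Q \<in> graded" for P Q c
    using that by (auto simp: fun_eq_iff bracket2_graded g component_scale br2_scale scale_sum_right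
        cochain_scale_def[of _ _ "br2 _ _ _ _"] cochain_scale_def[of _ _ "bracket2 _ _ _ _ _"] intro!: sum.cong)
  show ?thesis
    unfolding multilinear_on_def
  proof (intro allI impI, elim conjE)
    fix xs ys x y c
    assume "length xs + 1 + length ys = 2" and V: "set xs \<subseteq> graded" "set ys \<subseteq> graded" "x \<in> graded" "y \<in> graded"
    then consider z where "xs = []" "ys = [z]" | z where "xs = [z]" "ys = []"
      by (cases xs; cases ys) auto
    then show "bracket2 scale bracket bracket ((xs @ (x + y) # ys) ! 0) ((xs @ (x + y) # ys) ! 1) =
        bracket2 scale bracket bracket ((xs @ x # ys) ! 0) ((xs @ x # ys) ! 1)
        + bracket2 scale bracket bracket ((xs @ y # ys) ! 0) ((xs @ y # ys) ! 1) \<and>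
      bracket2 scale bracket bracket ((xs @ cochain_scale scale c x # ys) ! 0) ((xs @ cochain_scale scale c x # ys) ! 1) =
        cochain_scale scale c (bracket2 scale bracket bracket ((xs @ x # ys) ! 0) ((xs @ x # ys) ! 1))"
      by cases (use V in \<open>simp_all add: 1 2\<close>)
  qed
qed

lemma multilinear_bracket3:
  assumes two: "(2::'k) \<noteq> 0"
  shows "multilinear_on (cochain_scale scale) (cochain_scale scale) graded 3
    (\<lambda>xs. bracket3 scale (\<lambda>x y. - bracket x y) (xs ! 0) (xs ! 1) (xs ! 2))"
proof -
  let ?B = "bracket3 scale (\<lambda>x y. - bracket x y)"
  note g = graded_add graded_scale graded_alternating bracket3_graded[OF two]
  have 1: "?B (P + P') Q R = ?B P Q R + ?B P' Q R" "?B Q (P + P') R = ?B Q P R + ?B Q P' R"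
      "?B Q R (P + P') = ?B Q R P + ?B Q R P'"
    if "P \<in> graded" "P' \<in> graded" "Q \<in> graded" "R \<in> graded" for P P' Q R
    using that by (auto simp: fun_eq_iff g component_add br3_add
        simp flip: sum.distrib intro!: sum.cong)
  have 2: "?B (cochain_scale scale c P) Q R = cochain_scale scale c (?B P Q R)"
      "?B Q (cochain_scale scale c P) R = cochain_scale scale c (?B Q P R)"
      "?B Q R (cochain_scale scale c P) = cochain_scale scale c (?B Q R P)"
    if "P \<in> graded" "Q \<in> graded" "R \<in> graded" for P Q R c
    using that by (auto simp: fun_eq_iff g component_scale br3_scale scale_sum_right
        cochain_scale_def[of _ _ "br3 _ _ _ _ _ _"] cochain_scale_def[of _ _ "?B _ _ _"] intro!: sum.cong)
  show ?thesis
    unfolding multilinear_on_def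
  proof (intro allI impI, elim conjE)
    fix xs ys x y c
    assume "length xs + 1 + length ys = 3" and V: "set xs \<subseteq> graded" "set ys \<subseteq> graded" "x \<in> graded" "y \<in> graded"
    then consider z w where "xs = []" "ys = [z, w]" | z w where "xs = [z]" "ys = [w]"
      | z w where "xs = [z, w]" "ys = []"
      by (cases xs; cases ys; cases "tl xs"; cases "tl ys") auto
    then show "?B ((xs @ (x + y) # ys) ! 0) ((xs @ (x + y) # ys) ! 1) ((xs @ (x + y) # ys) ! 2) =
        ?B ((xs @ x # ys) ! 0) ((xs @ x # ys) ! 1) ((xs @ x # ys) ! 2)
        + ?B ((xs @ y # ys) ! 0) ((xs @ y # ys) ! 1) ((xs @ y # ys) ! 2) \<and>
      ?B ((xs @ cochain_scale scale c x # ys) ! 0) ((xs @ cochain_scale scale c x # ys) ! 1)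
          ((xs @ cochain_scale scale c x # ys) ! 2) =
        cochain_scale scale c (?B ((xs @ x # ys) ! 0) ((xs @ x # ys) ! 1) ((xs @ x # ys) ! 2))"
      by cases (use V in \<open>simp_all add: 1 2\<close>)
  qed
qed

text \<open>A cochain of degree \<open>j\<close> is supported on the lists of length
  \<open>j\<close>, so evaluating a vanishing sum at a list isolates one summand.\<close>

lemma graded_vector_space_cochains: "graded_vector_space (cochain_scale scale) (cochains scale)"
proof -
  interpret V: vector_space "cochain_scale scale :: 'k \<Rightarrow> ('g list \<Rightarrow> 'g) \<Rightarrow> _"
    by (rule vector_space_cochain)
  show ?thesis
  proof
    show "V.subspace (cochains scale i)" for i
      by (auto simp: V.subspace_def cochains_def Hom_zero Hom_add Hom_scale)
    fix I :: "int set" and x i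
    assume fin: "finite I" and x: "\<And>i. i \<in> I \<Longrightarrow> x i \<in> cochains scale i"
      and sum: "(\<Sum>i\<in>I. x i) = 0" and i: "i \<in> I"
    have supp: "x j us = 0" if "j \<in> I" "j \<noteq> int (length us)" for j us
      using x[OF that(1)] that(2) HomD(2)[of "x j" "nat j" us]
      by (auto simp: cochains_def split: if_splits)
    show "x i = 0"
    proof
      fix us
      show "x i us = 0 us"
      proof (cases "i = int (length us)")
        case True
        have "0 = (\<Sum>j\<in>I. x j us)" using fun_cong[OF sum, of us] by (simp add: sum_fun_apply)
        also have "\<dots> = (\<Sum>j\<in>{i}. x j us)"
          by (rule sum.mono_neutral_right) (use fin i supp True in auto)
        finally show ?thesis by simp
      qed (simp add: supp i)
    qed
  qed
qed

lemma total_subset_graded: "graded_vector_space.total (cochain_scale scale) (cochains scale) \<subseteq> graded"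
proof -
  interpret V: graded_vector_space "cochain_scale scale" "cochains scale"
    by (rule graded_vector_space_cochains)
  have "V.subspace graded"
    using graded_add graded_scale Hom_graded[OF Hom_zero] by (auto simp: V.subspace_def)
  then show ?thesis
    unfolding V.total_def
    by (rule V.span_minimal[rotated]) (auto simp: cochains_def Hom_graded Hom_graded[OF Hom_zero] split: if_splits)
qed

end

section \<open>The axioms of an \<open>L\<^sub>\<infinity>\<close>-algebra\<close>

lemma unshuffle3_cong: "(\<And>xs ys zs. F xs ys zs = G xs ys zs) \<Longrightarrow> unshuffle3 d us F = unshuffle3 d us G"
  by presburger

lemma block_upt:
  "\<sigma> permutes {..<n} \<Longrightarrow> b \<le> n \<Longrightarrow> block [0..<n] \<sigma> a b = map \<sigma> [a..<b]"
  using permutes_in_image[of \<sigma> "{..<n}"] by (auto simp: block_def)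

lemma upt_small:
  "[0..<2] = [0, 1]" "[0..<3] = [0, 1, 2]" "[0..<4] = [0, 1, 2, 3]" "[0..<5] = [0, 1, 2, 3, 4]"
  by (simp_all add: upt_rec eval_nat_numeral)

section \<open>Permutations of at most three indices\<close>

lemma permutes_1_eq: "\<sigma> permutes {..<1::nat} \<Longrightarrow> \<sigma> = ext_perm 0 id"
proof -
  assume "\<sigma> permutes {..<1::nat}"
  then obtain m \<sigma>' where "m \<le> 0" "\<sigma>' permutes {..<0::nat}" "\<sigma> = ext_perm m \<sigma>'"
    using permutes_ext_permE[of \<sigma> 0] by auto
  then show ?thesis by simp
qed

lemma permutes_2E:
  assumes "\<sigma> permutes {..<2::nat}"
  obtains m where "m \<le> 1" "\<sigma> = ext_perm m (ext_perm 0 id)"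
  using assms permutes_ext_permE[of \<sigma> 1] permutes_1_eq by (metis Suc_1)

text \<open>The pair \<open>m\<close>, \<open>m'\<close> is the inversion table of the permutation
  without its last entry 0; its six values exhaust the permutations of three indices.\<close>

lemma permutes_3E:
  assumes "\<sigma> permutes {..<3::nat}"
  obtains m m' where "m \<le> 2" "m' \<le> 1" "\<sigma> = ext_perm m (ext_perm m' (ext_perm 0 id))"
proof -
  obtain m \<sigma>' where "m \<le> 2" "\<sigma>' permutes {..<2}" "\<sigma> = ext_perm m \<sigma>'"
    using permutes_ext_permE[of \<sigma> 2] assms by (auto simp: numeral_3_eq_3 numeral_2_eq_2)
  with that show ?thesis by (metis permutes_2E)
qed

lemma shuffle_weight_2:
  assumes "m \<le> 1"
  shows "shuffle_weight d [a, b] (ext_perm m (ext_perm 0 id)) =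
    (if swap_parity d a (block [b] (ext_perm 0 id) 0 m) then -1 else 1)"
proof -
  have 0: "shuffle_weight d [] id = 1"
    by (simp add: shuffle_weight_def koszul_sign_def)
  have "shuffle_weight d [b] (ext_perm 0 id) = 1"
    using shuffle_weight_ext_perm[of id "[]" 0 d b] 0 by (simp add: swap_parity_def block_def permutes_id)
  then show ?thesis
    using shuffle_weight_ext_perm[of "ext_perm 0 id" "[b]" m d a] ext_perm_permutes[of id 0 0] assms
    by (simp add: permutes_id)
qed

lemma shuffle_weight_3:
  assumes "m \<le> 2" "m' \<le> 1"
  shows "shuffle_weight d [a, b, c] (ext_perm m (ext_perm m' (ext_perm 0 id))) =
    (if swap_parity d a (block [b, c] (ext_perm m' (ext_perm 0 id)) 0 m) then -1 else 1) *
    (if swap_parity d b (block [c] (ext_perm 0 id) 0 m') then -1 else 1)"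
proof -
  have "ext_perm m' (ext_perm 0 id) permutes {..<length [b, c]}"
    using ext_perm_permutes[OF ext_perm_permutes[of id 0 0], of m'] assms by (simp add: permutes_id)
  then show ?thesis
    using shuffle_weight_ext_perm[of "ext_perm m' (ext_perm 0 id)" "[b, c]" m d a] assms
    by (simp add: shuffle_weight_2)
qed

context lie_algebra begin

interpretation V: vector_space "cochain_scale scale :: 'k \<Rightarrow> ('g list \<Rightarrow> 'g) \<Rightarrow> _"
  by (rule vector_space_cochain)

abbreviation maps :: "nat \<Rightarrow> ('g list \<Rightarrow> 'g) list \<Rightarrow> ('g list \<Rightarrow> 'g)" where
  "maps \<equiv> reynolds_maps scale bracket"

lemma maps_2: "P \<in> Hom p \<Longrightarrow> Q \<in> Hom q \<Longrightarrow> maps 2 [P, Q] = br2 (odd p) P (odd q) Q"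
  by (simp add: reynolds_maps_def bracket2_Hom)

lemma maps_3:
  "(2::'k) \<noteq> 0 \<Longrightarrow> P \<in> Hom p \<Longrightarrow> Q \<in> Hom q \<Longrightarrow> R \<in> Hom r \<Longrightarrow>
    maps 3 [P, Q, R] = br3 (odd p) P (odd q) Q (odd r) R"
  by (simp add: reynolds_maps_def bracket3_Hom)

lemma maps_other: "k \<noteq> 2 \<Longrightarrow> k \<noteq> 3 \<Longrightarrow> maps k xs = 0"
  by (simp add: reynolds_maps_def)

lemma cochains_cases:
  assumes "P \<in> cochains scale d"
  obtains "0 \<le> d" "P \<in> Hom (nat d)" | "d < 0" "P = 0"
  using assms by (auto simp: cochains_def split: if_splits)

lemma zero_cochains: "0 \<in> cochains scale d"
  by (simp add: cochains_def Hom_zero)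

lemma maps_multilinear:
  assumes "(2::'k) \<noteq> 0"
  shows "multilinear_on (cochain_scale scale) (cochain_scale scale)
    (graded_vector_space.total (cochain_scale scale) (cochains scale)) k (maps k)"
proof -
  have sub: "multilinear_on sa sb W n f" if "multilinear_on sa sb V n f" "W \<subseteq> V" for sa sb V W n f
    unfolding multilinear_on_def
  proof (intro allI impI, elim conjE)
    fix xs ys x y c
    assume "length xs + 1 + length ys = n" "set xs \<subseteq> W" "set ys \<subseteq> W" "x \<in> W" "y \<in> W"
    then show "f (xs @ (x + y) # ys) = f (xs @ x # ys) + f (xs @ y # ys) \<and>
        f (xs @ sa c x # ys) = sb c (f (xs @ x # ys))"
      using that(1)[unfolded multilinear_on_def, rule_format, of xs ys x y c] that(2) by blast
  qed
  consider "k = 2" | "k = 3" | "k \<noteq> 2" "k \<noteq> 3" by blast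
  then show ?thesis
  proof cases
    case 1
    then have "maps k = (\<lambda>xs. bracket2 scale bracket bracket (xs ! 0) (xs ! 1))"
      by (simp add: reynolds_maps_def fun_eq_iff)
    then show ?thesis using sub[OF multilinear_bracket2 total_subset_graded] 1 by simp
  next
    case 2
    then have "maps k = (\<lambda>xs. bracket3 scale (\<lambda>x y. - bracket x y) (xs ! 0) (xs ! 1) (xs ! 2))"
      by (simp add: reynolds_maps_def fun_eq_iff)
    then show ?thesis using sub[OF multilinear_bracket3[OF assms] total_subset_graded] 2 by simp
  next
    case 3
    then show ?thesis by (auto simp: multilinear_on_def maps_other)
  qed
qed

lemma maps_degree:
  assumes two: "(2::'k) \<noteq> 0" and x: "\<And>i. i < k \<Longrightarrow> x i \<in> cochains scale (d i)"
  shows "maps k (map x [0..<k]) \<in> cochains scale ((\<Sum>i<k. d i) + 2 - int k)"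
proof -
  \<comment> \<open>A negative degree becomes 0 here. The cochain is then 0, which lies in
    \<open>Hom 0\<close>, and the degree claim holds because the bracket vanishes.\<close>
  define p where "p i = nat (d i)" for i
  have "x i \<in> Hom (p i) \<and> (d i \<noteq> int (p i) \<longrightarrow> x i = 0)" if "i < k" for i
    using x[OF that] by (rule cochains_cases) (auto simp: Hom_zero p_def)
  then have H: "i < k \<Longrightarrow> x i \<in> Hom (p i)" "i < k \<Longrightarrow> d i \<noteq> int (p i) \<Longrightarrow> x i = 0" for i
    by blast+
  note alt = H(1)[THEN HomD(1)]
  consider "k = 2" | "k = 3" | "k \<noteq> 2" "k \<noteq> 3" by blast
  then show ?thesis
  proof cases
    case 1
    then have m: "maps k (map x [0..<k]) = br2 (odd (p 0)) (x 0) (odd (p 1)) (x 1)"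
      using maps_2[of "x 0" "p 0" "x 1" "p 1"] H(1) by (simp add: upt_small)
    have sum: "(\<Sum>i<k. d i) + 2 - int k = d 0 + d 1" using 1 by (simp add: numeral_2_eq_2)
    show ?thesis
    proof (cases "d 0 = int (p 0) \<and> d 1 = int (p 1)")
      case True
      then show ?thesis
        unfolding m sum using Hom_br2[of "x 0" "p 0" "x 1" "p 1"] H(1) 1 by (simp add: cochains_def nat_add_distrib)
    next
      case False
      then have "maps k (map x [0..<k]) = 0"
        unfolding m using H(2)[of 0] H(2)[of 1] 1 br2_zero[OF alt[of 0]] br2_zero[OF alt[of 1]] by auto
      then show ?thesis by (simp add: zero_cochains)
    qed
  next
    case 2
    then have m: "maps k (map x [0..<k]) = br3 (odd (p 0)) (x 0) (odd (p 1)) (x 1) (odd (p 2)) (x 2)"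
      using maps_3[OF two, of "x 0" "p 0" "x 1" "p 1" "x 2" "p 2"] H(1) by (simp add: upt_small)
    have sum: "(\<Sum>i<k. d i) + 2 - int k = d 0 + d 1 + d 2 - 1" using 2 by (simp add: numeral_3_eq_3 numeral_2_eq_2)
    show ?thesis
    proof (cases "d 0 = int (p 0) \<and> d 1 = int (p 1) \<and> d 2 = int (p 2)")
      case True
      note d = True
      show ?thesis
      proof (cases "p 0 + p 1 + p 2")
        case 0
        then have "maps k (map x [0..<k]) = 0"
          unfolding m using br3_eq_0[of "x 0" "x 1" "x 2"] H(1)[of 0] H(1)[of 1] H(1)[of 2] 2 by simp
        then show ?thesis by (simp add: zero_cochains)
      next
        case (Suc n)
        then have "d 0 + d 1 + d 2 - 1 = int n" using d by simp
        then show ?thesis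
          unfolding m sum using Hom_br3[of "x 0" "p 0" "x 1" "p 1" "x 2" "p 2" n] H(1) 2 Suc
          by (simp add: cochains_def)
      qed
    next
      case False
      then have "maps k (map x [0..<k]) = 0"
        unfolding m using H(2)[of 0] H(2)[of 1] H(2)[of 2] 2 alt[of 0] alt[of 1] alt[of 2]
        by (auto simp: br3_zero)
      then show ?thesis by (simp add: zero_cochains)
    qed
  next
    case 3
    then show ?thesis by (simp add: maps_other zero_cochains)
  qed
qed

text \<open>A cochain of negative degree is zero, so degrees may be replaced by their absolute values.\<close>

lemma nonneg_degrees:
  assumes "\<And>i. i < n \<Longrightarrow> x i \<in> cochains scale (d i)"
  obtains y p where "\<And>i. y i \<in> Hom (p i)" "\<And>i. i < n \<Longrightarrow> y i = x i"
    "\<And>i. i < n \<Longrightarrow> even (d i) = even (int (p i))"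
proof (rule that)
  show "(if i < n then x i else 0) \<in> Hom (nat \<bar>d i\<bar>)" for i
  proof (cases "i < n")
    case True
    from assms[OF this] show ?thesis by (rule cochains_cases) (simp_all add: True Hom_zero)
  qed (simp add: Hom_zero)
qed auto

lemma maps_antisymmetric:
  assumes two: "(2::'k) \<noteq> 0" and x: "\<And>i. i < k \<Longrightarrow> x i \<in> cochains scale (d i)"
    and \<sigma>: "\<sigma> permutes {..<k}"
  shows "maps k (map (x \<circ> \<sigma>) [0..<k]) =
    cochain_scale scale (of_int (sign \<sigma> * koszul_sign k d \<sigma>)) (maps k (map x [0..<k]))"
proof -
  obtain y p where y: "\<And>i. y i \<in> Hom (p i)" and yx: "\<And>i. i < k \<Longrightarrow> y i = x i"
    and p: "\<And>i. i < k \<Longrightarrow> even (d i) = even (int (p i))"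
    using nonneg_degrees[of k x d] x by blast
  note h = Hom_homog[OF y]
  have w: "sign \<sigma> * koszul_sign k d \<sigma> = shuffle_weight (\<lambda>i. int (p i)) [0..<k] \<sigma>"
    by (rule shuffle_weight_upt[OF \<sigma> p, symmetric])
  have yx': "map (x \<circ> \<sigma>) [0..<k] = map (\<lambda>i. y (\<sigma> i)) [0..<k]" "map x [0..<k] = map y [0..<k]"
    using yx permutes_in_image[OF \<sigma>] by auto
  consider "k = 2" | "k = 3" | "k \<noteq> 2" "k \<noteq> 3" by blast
  then show ?thesis
  proof cases
    case 1
    obtain m where m: "m \<le> 1" "\<sigma> = ext_perm m (ext_perm 0 id)" using \<sigma> 1 permutes_2E by blast
    have w': "shuffle_weight (\<lambda>i. int (p i)) [0..<k] \<sigma> =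
        (if swap_parity (\<lambda>i. int (p i)) 0 (block [1] (ext_perm 0 id) 0 m) then -1 else 1)"
      unfolding 1 upt_small m(2) by (rule shuffle_weight_2[OF m(1)])
    have "m = 0 \<or> m = 1" using m(1) by auto
    then show ?thesis
      unfolding yx' w w' unfolding 1 upt_small m(2)
      using br2_commute[OF h[of 0] h[of 1]]
      by (auto simp: swap_parity_def block_def ext_perm_def maps_2[OF y y])
  next
    case 2
    obtain m m' where m: "m \<le> 2" "m' \<le> 1" "\<sigma> = ext_perm m (ext_perm m' (ext_perm 0 id))"
      using \<sigma> 2 permutes_3E by blast
    have w': "shuffle_weight (\<lambda>i. int (p i)) [0..<k] \<sigma> =
        (if swap_parity (\<lambda>i. int (p i)) 0 (block [1, 2] (ext_perm m' (ext_perm 0 id)) 0 m) then -1 else 1) *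
        (if swap_parity (\<lambda>i. int (p i)) 1 (block [2] (ext_perm 0 id) 0 m') then -1 else 1)"
      unfolding 2 upt_small m(3) by (rule shuffle_weight_3[OF m(1,2)])
    have "m = 0 \<or> m = 1 \<or> m = 2" "m' = 0 \<or> m' = 1" using m(1,2) by auto
    then show ?thesis
      unfolding yx' w w' unfolding 2 upt_small m(3)
      \<comment> \<open>Permutations longer than a transposition of neighbours pass through
        intermediate orders of the arguments, hence the further instances.\<close>
      using br3_commute[OF h[of 0] h[of 1] h[of 2]] br3_commute(2)[OF h[of 1] h[of 0] h[of 2]]
        br3_commute(1)[OF h[of 0] h[of 2] h[of 1]] br3_commute(1)[OF h[of 1] h[of 2] h[of 0]]
      by (elim disjE; cases "even (p 0)"; cases "even (p 1)"; cases "even (p 2)";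
        simp add: swap_parity_def block_def ext_perm_def upt_small maps_3[OF two y y y] flip: numeral_2_eq_2)
  next
    case 3
    then show ?thesis by (simp add: maps_other)
  qed
qed

text \<open>The inner sums become unshuffle sums over the labels \<open>[0..<n]\<close>. A term
  survives only if both \<open>i\<close> and \<open>n + 1 - i\<close> are 2 or 3, which leaves
  \<open>n = 3, 4, 5\<close>.\<close>

lemma maps_jacobi:
  assumes two: "(2::'k) \<noteq> 0" and x: "\<And>i. i < n \<Longrightarrow> x i \<in> cochains scale (d i)"
  shows "(\<Sum>i\<in>{1..n}. \<Sum>\<sigma>\<in>Sh2 i (n - i).
         cochain_scale scale (of_int (sign \<sigma> * koszul_sign n d \<sigma>) * (-1) ^ (i * (n - i)))
           (maps (n + 1 - i) (maps i (map (x \<circ> \<sigma>) [0..<i]) # map (x \<circ> \<sigma>) [i..<n]))) = 0"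
proof -
  obtain y p where y: "\<And>i. y i \<in> Hom (p i)" and yx: "\<And>i. i < n \<Longrightarrow> y i = x i"
    and p: "\<And>i. i < n \<Longrightarrow> even (d i) = even (int (p i))"
    using nonneg_degrees[of n x d] x by blast
  let ?e = "\<lambda>i. int (p i)"
  have h: "homog (odd (?e i)) (y i)" for i
    using Hom_homog[OF y] by simp
  let ?F = "\<lambda>i xs ys. maps (n + 1 - i) (maps i (map y xs) # map y ys)"
  let ?U = "\<lambda>i. unshuffle3 ?e [0..<n] (\<lambda>xs ys zs. only_if (length xs = i \<and> length ys = n - i \<and> length zs = 0) (?F i xs ys))"
  have summand: "(\<Sum>\<sigma>\<in>Sh2 i (n - i).
         cochain_scale scale (of_int (sign \<sigma> * koszul_sign n d \<sigma>) * (-1) ^ (i * (n - i)))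
           (maps (n + 1 - i) (maps i (map (x \<circ> \<sigma>) [0..<i]) # map (x \<circ> \<sigma>) [i..<n]))) =
      cochain_scale scale ((-1) ^ (i * (n - i))) (?U i)" if i: "i \<in> {1..n}" for i
  proof -
    have "(\<Sum>\<sigma>\<in>Sh2 i (n - i).
         cochain_scale scale (of_int (sign \<sigma> * koszul_sign n d \<sigma>) * (-1) ^ (i * (n - i)))
           (maps (n + 1 - i) (maps i (map (x \<circ> \<sigma>) [0..<i]) # map (x \<circ> \<sigma>) [i..<n]))) =
      (\<Sum>\<sigma>\<in>Sh2 i (n - i). cochain_scale scale ((-1) ^ (i * (n - i)))
         (cochain_scale scale (of_int (shuffle_weight ?e [0..<n] \<sigma>))
         (?F i (block [0..<n] \<sigma> 0 i) (block [0..<n] \<sigma> i (i + (n - i))))))"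
    proof (rule sum.cong[OF refl])
      fix \<sigma> assume "\<sigma> \<in> Sh2 i (n - i)"
      then have \<sigma>: "\<sigma> permutes {..<n}" using i by (simp add: Sh2_def)
      have "map (x \<circ> \<sigma>) [a..<b] = map y (block [0..<n] \<sigma> a b)" if "b \<le> n" for a b
        unfolding block_upt[OF \<sigma> that] using that yx permutes_in_image[OF \<sigma>] by auto
      then show "cochain_scale scale (of_int (sign \<sigma> * koszul_sign n d \<sigma>) * (-1) ^ (i * (n - i)))
           (maps (n + 1 - i) (maps i (map (x \<circ> \<sigma>) [0..<i]) # map (x \<circ> \<sigma>) [i..<n])) =
         cochain_scale scale ((-1) ^ (i * (n - i)))
         (cochain_scale scale (of_int (shuffle_weight ?e [0..<n] \<sigma>))
         (?F i (block [0..<n] \<sigma> 0 i) (block [0..<n] \<sigma> i (i + (n - i)))))"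
        using i by (simp add: shuffle_weight_upt[OF \<sigma> p] V.scale_scale mult.commute)
    qed
    also have "\<dots> = cochain_scale scale ((-1) ^ (i * (n - i)))
      (\<Sum>\<sigma>\<in>Sh2 i (n - i). cochain_scale scale (of_int (shuffle_weight ?e [0..<n] \<sigma>))
         (?F i (block [0..<n] \<sigma> 0 i) (block [0..<n] \<sigma> i (i + (n - i)))))"
      by (rule V.scale_sum_right[symmetric])
    also have "\<dots> = cochain_scale scale ((-1) ^ (i * (n - i))) (?U i)"
      using i by (subst V.sum_Sh2_eq_unshuffle3) simp_all
    finally show ?thesis .
  qed
  have vanish: "?U i = 0" if "i \<notin> {2, 3} \<or> n + 1 - i \<notin> {2, 3}" for i
  proof -
    have "only_if (length xs = i \<and> length ys = n - i \<and> length zs = 0) (?F i xs ys) = 0" for xs ys zs :: "nat list"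
    proof (cases "length xs = i \<and> length ys = n - i \<and> n + 1 - i \<in> {2, 3}")
      case True
      \<comment> \<open>The inner map is trivial, but the outer one is still applied to 0 and has to
        be shown to vanish there.\<close>
      then have 0: "maps i (map y xs) = 0" using that by (simp add: maps_other)
      consider a where "ys = [a]" "n + 1 - i = 2" | a b where "ys = [a, b]" "n + 1 - i = 3"
      proof -
        have "length ys = 1 \<and> n + 1 - i = 2 \<or> length ys = 2 \<and> n + 1 - i = 3" using True by auto
        then show thesis using that by (auto simp: length_Suc_conv numeral_2_eq_2)
      qed
      then have "?F i xs ys = 0"
        unfolding 0 using maps_2[OF Hom_zero y] maps_3[OF two Hom_zero y y] br2_zero[OF HomD(1)[OF y]]
          br3_zero[OF HomD(1)[OF y] HomD(1)[OF y]] by cases auto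
      then show ?thesis by (simp add: only_if_def)
    qed (auto simp: only_if_def maps_other)
    then show ?thesis by simp
  qed
  have F2: "maps 2 (map y xs) = br2 (odd (?e (xs ! 0))) (y (xs ! 0)) (odd (?e (xs ! 1))) (y (xs ! 1)) \<and>
      maps 2 (map y xs) \<in> Hom (p (xs ! 0) + p (xs ! 1))" if len: "length xs = 2" for xs
  proof -
    obtain a b where xs: "xs = [a, b]" using len by (cases xs; cases "tl xs") auto
    show ?thesis unfolding xs using maps_2[OF y y, of a b] Hom_br2[OF y y] by simp
  qed
  \<comment> \<open>Only the parity of the degree is recorded, since for three maps without
    arguments the formal degree is -1.\<close>
  have F3: "maps 3 (map y xs) = br3 (odd (?e (xs ! 0))) (y (xs ! 0)) (odd (?e (xs ! 1))) (y (xs ! 1))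
        (odd (?e (xs ! 2))) (y (xs ! 2)) \<and>
      (\<exists>m. maps 3 (map y xs) \<in> Hom m \<and> odd m = even (?e (xs ! 0) + ?e (xs ! 1) + ?e (xs ! 2)))"
    if len: "length xs = 3" for xs
  proof -
    obtain a b c where xs: "xs = [a, b, c]" using len by (cases xs; cases "tl xs"; cases "tl (tl xs)") auto
    obtain m where "maps 3 [y a, y b, y c] \<in> Hom m" "odd m \<longleftrightarrow> even (p a + p b + p c)"
      unfolding maps_3[OF two y y y] by (rule Hom_br3_parity[OF y y y])
    then show ?thesis unfolding xs using maps_3[OF two y y y, of a b c] by auto
  qed
  have "(\<Sum>i\<in>{1..n}. cochain_scale scale ((-1) ^ (i * (n - i))) (?U i)) = 0"
  proof -
    consider "n = 3" | "n = 4" | "n = 5" | "n \<notin> {3, 4, 5}" by blast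
    then show ?thesis
    proof cases
      case 1
      have "?U 2 = unshuffle3 ?e [0, 1, 2] (\<lambda>xs ys zs. only_if (length xs = 2 \<and> length ys = 1 \<and> length zs = 0)
          (br2 (odd (?e (xs ! 0) + ?e (xs ! 1)))
            (br2 (odd (?e (xs ! 0))) (y (xs ! 0)) (odd (?e (xs ! 1))) (y (xs ! 1)))
            (odd (?e (ys ! 0))) (y (ys ! 0))))"
        unfolding 1 upt_small
      proof (rule unshuffle3_cong)
        fix xs ys zs :: "nat list"
        show "only_if (length xs = 2 \<and> length ys = 3 - 2 \<and> length zs = 0)
            (maps (3 + 1 - 2) (maps 2 (map y xs) # map y ys)) =
          only_if (length xs = 2 \<and> length ys = 1 \<and> length zs = 0)
          (br2 (odd (?e (xs ! 0) + ?e (xs ! 1)))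
            (br2 (odd (?e (xs ! 0))) (y (xs ! 0)) (odd (?e (xs ! 1))) (y (xs ! 1)))
            (odd (?e (ys ! 0))) (y (ys ! 0)))"
        proof (cases "length xs = 2 \<and> length ys = 1")
          case True
          then obtain a where ys: "ys = [a]" by (cases ys) auto
          show ?thesis
            using F2[of xs] True maps_2[OF conjunct2[OF F2[of xs]] y[of a]] by (simp add: ys)
        qed (auto simp: only_if_def)
      qed
      also have "\<dots> = 0" by (rule jacobi3[of ?e]) (rule h)+
      finally have "?U 2 = 0" .
      then have "?U i = 0" for i
        using vanish[of i] 1 by (cases "i = 2") auto
      then show ?thesis by simp
    next
      case 2
      have "?U 2 = unshuffle3 ?e [0, 1, 2, 3] (\<lambda>xs ys zs. only_if (length xs = 2 \<and> length ys = 2 \<and> length zs = 0)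
          (br3 (odd (?e (xs ! 0) + ?e (xs ! 1)))
            (br2 (odd (?e (xs ! 0))) (y (xs ! 0)) (odd (?e (xs ! 1))) (y (xs ! 1)))
            (odd (?e (ys ! 0))) (y (ys ! 0)) (odd (?e (ys ! 1))) (y (ys ! 1))))"
        unfolding 2 upt_small
      proof (rule unshuffle3_cong)
        fix xs ys zs :: "nat list"
        show "only_if (length xs = 2 \<and> length ys = 4 - 2 \<and> length zs = 0)
            (maps (4 + 1 - 2) (maps 2 (map y xs) # map y ys)) =
          only_if (length xs = 2 \<and> length ys = 2 \<and> length zs = 0)
          (br3 (odd (?e (xs ! 0) + ?e (xs ! 1)))
            (br2 (odd (?e (xs ! 0))) (y (xs ! 0)) (odd (?e (xs ! 1))) (y (xs ! 1)))
            (odd (?e (ys ! 0))) (y (ys ! 0)) (odd (?e (ys ! 1))) (y (ys ! 1)))"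
        proof (cases "length xs = 2 \<and> length ys = 2")
          case True
          then obtain a b where ys: "ys = [a, b]" by (cases ys; cases "tl ys") auto
          show ?thesis
            using F2[of xs] True maps_3[OF two conjunct2[OF F2[of xs]] y[of a] y[of b]] by (simp add: ys)
        qed (auto simp: only_if_def)
      qed
      also have "\<dots> = unshuffle3 ?e [0, 1, 2, 3] (\<lambda>xs ys zs. only_if (length xs = 3 \<and> length ys = 1 \<and> length zs = 0)
          (br2 (even (?e (xs ! 0) + ?e (xs ! 1) + ?e (xs ! 2)))
            (br3 (odd (?e (xs ! 0))) (y (xs ! 0)) (odd (?e (xs ! 1))) (y (xs ! 1)) (odd (?e (xs ! 2))) (y (xs ! 2)))
            (odd (?e (ys ! 0))) (y (ys ! 0))))"
        by (rule jacobi4[of ?e]) (rule h)+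
      also have "\<dots> = ?U 3"
        unfolding 2 upt_small
      proof (rule unshuffle3_cong)
        fix xs ys zs :: "nat list"
        show "only_if (length xs = 3 \<and> length ys = 1 \<and> length zs = 0)
          (br2 (even (?e (xs ! 0) + ?e (xs ! 1) + ?e (xs ! 2)))
            (br3 (odd (?e (xs ! 0))) (y (xs ! 0)) (odd (?e (xs ! 1))) (y (xs ! 1)) (odd (?e (xs ! 2))) (y (xs ! 2)))
            (odd (?e (ys ! 0))) (y (ys ! 0))) =
          only_if (length xs = 3 \<and> length ys = 4 - 3 \<and> length zs = 0)
            (maps (4 + 1 - 3) (maps 3 (map y xs) # map y ys))"
        proof (cases "length xs = 3 \<and> length ys = 1")
          case True
          then obtain a where ys: "ys = [a]" by (cases ys) auto
          obtain m where m: "maps 3 (map y xs) \<in> Hom m" "odd m = even (?e (xs ! 0) + ?e (xs ! 1) + ?e (xs ! 2))"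
            using F3[of xs] True by blast
          show ?thesis
            using conjunct1[OF F3[of xs]] True maps_2[OF m(1) y[of a]] unfolding m(2) by (simp add: ys)
        qed (auto simp: only_if_def)
      qed
      finally have "?U 2 = ?U 3" .
      moreover have "(\<Sum>i\<in>{1..n}. cochain_scale scale ((-1) ^ (i * (n - i))) (?U i)) =
          (\<Sum>i\<in>{2, 3}. cochain_scale scale ((-1) ^ (i * (n - i))) (?U i))"
        by (rule sum.mono_neutral_right) (use 2 vanish in auto)
      ultimately show ?thesis using 2 by simp
    next
      case 3
      have "?U 3 = unshuffle3 ?e [0, 1, 2, 3, 4] (\<lambda>xs ys zs. only_if (length xs = 3 \<and> length ys = 2 \<and> length zs = 0)
          (br3 (even (?e (xs ! 0) + ?e (xs ! 1) + ?e (xs ! 2)))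
            (br3 (odd (?e (xs ! 0))) (y (xs ! 0)) (odd (?e (xs ! 1))) (y (xs ! 1)) (odd (?e (xs ! 2))) (y (xs ! 2)))
            (odd (?e (ys ! 0))) (y (ys ! 0)) (odd (?e (ys ! 1))) (y (ys ! 1))))"
        unfolding 3 upt_small
      proof (rule unshuffle3_cong)
        fix xs ys zs :: "nat list"
        show "only_if (length xs = 3 \<and> length ys = 5 - 3 \<and> length zs = 0)
            (maps (5 + 1 - 3) (maps 3 (map y xs) # map y ys)) =
          only_if (length xs = 3 \<and> length ys = 2 \<and> length zs = 0)
          (br3 (even (?e (xs ! 0) + ?e (xs ! 1) + ?e (xs ! 2)))
            (br3 (odd (?e (xs ! 0))) (y (xs ! 0)) (odd (?e (xs ! 1))) (y (xs ! 1)) (odd (?e (xs ! 2))) (y (xs ! 2)))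
            (odd (?e (ys ! 0))) (y (ys ! 0)) (odd (?e (ys ! 1))) (y (ys ! 1)))"
        proof (cases "length xs = 3 \<and> length ys = 2")
          case True
          then obtain a b where ys: "ys = [a, b]" by (cases ys; cases "tl ys") auto
          obtain m where m: "maps 3 (map y xs) \<in> Hom m" "odd m = even (?e (xs ! 0) + ?e (xs ! 1) + ?e (xs ! 2))"
            using F3[of xs] True by blast
          show ?thesis
            using conjunct1[OF F3[of xs]] True maps_3[OF two m(1) y[of a] y[of b]] unfolding m(2) by (simp add: ys)
        qed (auto simp: only_if_def)
      qed
      also have "\<dots> = 0" by (rule jacobi5[of ?e]) (rule h)+
      finally have "?U 3 = 0" .
      then have "?U i = 0" for i
        using vanish[of i] 3 by (cases "i = 3") auto
      then show ?thesis by simp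
    next
      case 4
      then have "?U i = 0" for i
        by (intro vanish) auto
      then show ?thesis by simp
    qed
  qed
  then show ?thesis by (simp only: summand cong: sum.cong)
qed

end

section \<open>Reynolds operators as Maurer-Cartan elements\<close>

context lie_algebra begin

lemma L_infinity_algebra_maps:
  assumes two: "(2::'k) \<noteq> 0"
  shows "L_infinity_algebra (cochain_scale scale) (cochains scale) maps"
proof (rule L_infinity_algebra.intro[OF graded_vector_space_cochains], rule L_infinity_algebra_axioms.intro)
  show "multilinear_on (cochain_scale scale) (cochain_scale scale)
      (graded_vector_space.total (cochain_scale scale) (cochains scale)) k (maps k)" for k
    by (rule maps_multilinear[OF two])
qed (use maps_degree[OF two] maps_antisymmetric[OF two] maps_jacobi[OF two] in blast)+

section \<open>Linear maps as cochains of degree one\<close>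

lemma linear_cochain_Hom:
  assumes "Vector_Spaces.linear scale scale R"
  shows "linear_cochain R \<in> Hom 1"
proof -
  interpret R: Vector_Spaces.linear scale scale R by fact
  show ?thesis
    by (auto simp: Hom_wedge_iff alternating_def linear_cochain_def append_eq_Cons_conv R.add R.scale)
qed

text \<open>For an odd map paired with itself the two action terms are equal, and antisymmetry of
  the bracket doubles the product term.\<close>

lemma br2_linear_cochain:
  assumes "Vector_Spaces.linear scale scale R"
  shows "br2 True (linear_cochain R) True (linear_cochain R) [u, v] =
    scale 2 (R (bracket (R u) v + bracket u (R v)) - bracket (R u) (R v))"
proof -
  interpret R: Vector_Spaces.linear scale scale R by fact
  have d: "scale 2 x = x + x" for x using scale_left_distrib[of 1 1 x] by simp
  have "bracket u (R v) = - bracket (R v) u" "bracket (R u) (R v) = - bracket (R v) (R u)"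
    by (rule bracket_anticommute)+
  then show ?thesis
    unfolding d by (simp add: br2_def act_def ins_def conv_def unit_cochain_def linear_cochain_def
        contr_def bracket_simps R.add R.diff R.neg R.zero)
qed

text \<open>The 6 is three equal choices of the outer map times two equal orders of the
  arguments.\<close>

lemma br3_linear_cochain:
  assumes "Vector_Spaces.linear scale scale R"
  shows "br3 True (linear_cochain R) True (linear_cochain R) True (linear_cochain R) [u, v] =
    scale 6 (R (bracket (R u) (R v)))"
proof -
  interpret R: Vector_Spaces.linear scale scale R by fact
  have "scale (1 + 1 + 1 + 1 + 1 + 1) x = x + x + x + x + x + x" for x
    by (simp only: scale_left_distrib scale_one)
  then have d: "scale 6 x = x + x + x + x + x + x" for x by simp
  have "bracket (R u) (R v) = - bracket (R v) (R u)"
    by (rule bracket_anticommute)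
  then show ?thesis
    unfolding d by (simp add: br3_def ins_def conv_def linear_cochain_def
        bracket_simps R.add R.diff R.neg R.zero)
qed

end

text \<open>On pairs the factors 2 and 6 cancel the factorials, and the expression is the difference
  of the two sides of the Reynolds identity. On lists of other lengths it is zero, having degree
  2.\<close>

lemma (in lie_algebra) reynolds_iff_maurer_cartan:
  fixes R :: "'g \<Rightarrow> 'g"
  assumes char: "(6::'k) \<noteq> 0" and R: "Vector_Spaces.linear scale scale R"
  shows "reynolds_operator scale bracket R \<longleftrightarrow>
    cochain_scale scale (1 / 2) (maps 2 [linear_cochain R, linear_cochain R])
    - cochain_scale scale (1 / 6) (maps 3 [linear_cochain R, linear_cochain R, linear_cochain R]) = 0"
    (is "_ \<longleftrightarrow> ?MC = 0")
proof -
  interpret R: Vector_Spaces.linear scale scale R by fact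
  have two: "(2::'k) \<noteq> 0" using char by (metis mult_zero_left numeral_Bit0_eq_double numeral_times_numeral semiring_norm)
  note H = linear_cochain_Hom[OF R]
  have MC2: "?MC [u, v] = R (bracket (R u) v + bracket u (R v) - bracket (R u) (R v)) - bracket (R u) (R v)" for u v
    using maps_2[OF H H] maps_3[OF two H H H] char two
    by (simp add: cochain_scale_def br2_linear_cochain[OF R] br3_linear_cochain[OF R] R.diff)
  have MC0: "?MC us = 0" if "length us \<noteq> 2" for us
    using maps_2[OF H H] maps_3[OF two H H H] HomD(2)[OF Hom_br2[OF H H]] HomD(2)[OF Hom_br3[OF H H H, of 2]] that
    by (simp add: cochain_scale_def)
  have "?MC = 0 \<longleftrightarrow> (\<forall>u v. ?MC [u, v] = 0)"
  proof
    assume MC: "\<forall>u v. ?MC [u, v] = 0"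
    show "?MC = 0"
    proof
      fix us show "?MC us = 0 us"
      proof (cases "length us = 2")
        case True
        then obtain u v where "us = [u, v]" by (auto simp: length_Suc_conv numeral_2_eq_2)
        then show ?thesis using MC by simp
      qed (use MC0 in simp)
    qed
  qed simp
  also have "\<dots> \<longleftrightarrow> reynolds_operator scale bracket R"
    unfolding MC2 reynolds_operator_def using R by (metis eq_iff_diff_eq_0)
  finally show ?thesis by blast
qed

theorem theorem5p1:
  fixes scale :: "'k::field_char_0 \<Rightarrow> 'g::ab_group_add \<Rightarrow> 'g"
    and \<mu> :: "'g \<Rightarrow> 'g \<Rightarrow> 'g"
  assumes "lie_algebra scale \<mu>"
  shows "L_infinity_algebra (cochain_scale scale) (cochains scale) (reynolds_maps scale \<mu>) \<and>
    (\<forall>R. Vector_Spaces.linear scale scale R \<longrightarrow>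
      (reynolds_operator scale \<mu> R \<longleftrightarrow>
       maurer_cartan (cochain_scale scale) (cochains scale) (reynolds_maps scale \<mu>)
         (linear_cochain R)))"
proof -
  interpret lie_algebra scale \<mu> by fact
  \<comment> \<open>Membership in degree 1 is automatic for linear maps, so only the equation
    remains.\<close>
  have "linear_cochain R \<in> cochains scale 1" if "Vector_Spaces.linear scale scale R" for R
    using linear_cochain_Hom[OF that] by (simp add: cochains_def)
  then show ?thesis
    using L_infinity_algebra_maps reynolds_iff_maurer_cartan
      maurer_cartan_l2_l3[OF vector_space_cochain, of maps "cochains scale"] maps_other
    by simp
qed

end
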